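(* Let $1<p<\infty$ and let $p^{*}$ be the conjugate exponent of $p$, i.e. $\frac1p+\frac1{p^{*}}=1$. Then the James $p$-space $J_{p}$ has property $p^{*}$-$(V)$.
   Context: Operators are bounded linear operators. For $1\le r<\infty$, a sequence $(x_n)_n$ in a Banach space $X$ is weakly $r$-summable if $\sum_{n}|\langle x^{*},x_n\rangle|^{r}<\infty$ for every $x^{*}\in X^{*}$; it is unconditionally $r$-summable if moreover $\sup\{(\sum_{n=m}^{\infty}|\langle x^{*},x_n\rangle|^{r})^{1/r}: x^{*}\in B_{X^{*}}\}\to 0$ as $m\to\infty$, where $B_{X^*}$ is the closed unit ball of $X^*$. An operator $T:X\to Y$ is unconditionally $r$-converging if it takes weakly $r$-summable sequences in $X$ to unconditionally $r$-summable sequences in $Y$. A Banach space $X$ has property $r$-$(V)$ (Pe{\l}czy\'nski's property $(V)$ of order $r$) if for every Banach space $Y$, every unconditionally $r$-converging operator $T:X\to Y$ is weakly compact. The James $p$-space $J_p$ ($1<p<\infty$) is the real Banach space of all real sequences $(a_n)_n$ with $\lim_n a_n=0$ and $$\|(a_{n})_{n}\|_{cpv}=\frac{1}{2^{1/p}}\sup\Big\{\Big(\sum_{j=1}^{m}|a_{i_{j-1}}-a_{i_{j}}|^{p}+|a_{i_{m}}-a_{i_{0}}|^{p}\Big)^{1/p}:1\leq i_{0}<i_{1}<\cdots<i_{m},\ m\in \mathbb{N}\Big\}<\infty,$$ with norm $\|\cdot\|_{cpv}$. An equivalent norm is $\|(a_n)_n\|_{pv}=\sup\{(\sum_{j=1}^{m}|a_{i_{j-1}}-a_{i_{j}}|^{p})^{1/p}:1\leq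 i_{0}<\cdots<i_{m},\ m\in\mathbb{N}\}$. *)

theory Defs
  imports "HOL-Analysis.Analysis" "HOL-Library.Function_Algebras"
begin

section \<open>Normed spaces on a carrier\<close>

text \<open>
  The space \<open>J\<^sub>p\<close> depends on a real parameter, so it cannot be a type of class \<open>banach\<close>. The domain
  of an operator is therefore a linear subspace \<open>S\<close> of a real vector space together with a norm
  \<open>N\<close> on \<open>S\<close>; functions are only ever looked at on \<open>S\<close>. A type of class \<open>banach\<close> is the
  case \<open>S = UNIV\<close>, \<open>N = norm\<close>.
\<close>

definition banach_space_on :: "'a::real_vector set \<Rightarrow> ('a \<Rightarrow> real) \<Rightarrow> bool" where
  "banach_space_on S N \<longleftrightarrow>
     subspace S \<and>
     (\<forall>x\<in>S. 0 \<le> N x) \<and>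
     (\<forall>x\<in>S. N x = 0 \<longrightarrow> x = 0) \<and>
     (\<forall>x\<in>S. \<forall>c. N (c *\<^sub>R x) = \<bar>c\<bar> * N x) \<and>
     (\<forall>x\<in>S. \<forall>y\<in>S. N (x + y) \<le> N x + N y) \<and>
     (\<forall>X :: nat \<Rightarrow> 'a. (\<forall>n. X n \<in> S) \<longrightarrow>
        (\<forall>e>0. \<exists>M. \<forall>m\<ge>M. \<forall>n\<ge>M. N (X m - X n) < e) \<longrightarrow>
        (\<exists>x\<in>S. (\<lambda>n. N (X n - x)) \<longlonglongrightarrow> 0))"

definition bounded_operator_on ::
    "'a::real_vector set \<Rightarrow> ('a \<Rightarrow> real) \<Rightarrow> ('a \<Rightarrow> 'b::real_normed_vector) \<Rightarrow> bool" where
  "bounded_operator_on S N T \<longleftrightarrow>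
     (\<forall>x\<in>S. \<forall>y\<in>S. T (x + y) = T x + T y) \<and>
     (\<forall>x\<in>S. \<forall>c. T (c *\<^sub>R x) = c *\<^sub>R T x) \<and>
     (\<exists>K. \<forall>x\<in>S. norm (T x) \<le> K * N x)"

definition dual_on :: "'a::real_vector set \<Rightarrow> ('a \<Rightarrow> real) \<Rightarrow> ('a \<Rightarrow> real) set" where
  "dual_on S N = {f. bounded_operator_on S N f}"

definition unit_ball_on :: "'a::real_vector set \<Rightarrow> ('a \<Rightarrow> real) \<Rightarrow> 'a set" where
  "unit_ball_on S N = {x\<in>S. N x \<le> 1}"

definition dual_norm_on :: "'a::real_vector set \<Rightarrow> ('a \<Rightarrow> real) \<Rightarrow> ('a \<Rightarrow> real) \<Rightarrow> real" where
  "dual_norm_on S N f = (SUP x\<in>unit_ball_on S N. \<bar>f x\<bar>)"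

definition dual_unit_ball_on :: "'a::real_vector set \<Rightarrow> ('a \<Rightarrow> real) \<Rightarrow> ('a \<Rightarrow> real) set" where
  "dual_unit_ball_on S N = {f \<in> dual_on S N. dual_norm_on S N f \<le> 1}"

text \<open>The coarsest topology on \<open>S\<close> that makes all bounded functionals continuous.\<close>

definition weak_topology_on :: "'a::real_vector set \<Rightarrow> ('a \<Rightarrow> real) \<Rightarrow> 'a topology" where
  "weak_topology_on S N =
     topology_generated_by {{x\<in>S. f x \<in> U} | f U. f \<in> dual_on S N \<and> open U}"

definition weakly_compact_operator_on ::
    "'a::real_vector set \<Rightarrow> ('a \<Rightarrow> real) \<Rightarrow> ('a \<Rightarrow> 'b::real_normed_vector) \<Rightarrow> bool" where
  "weakly_compact_operator_on S N T \<longleftrightarrow>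
     bounded_operator_on S N T \<and>
     (let W = weak_topology_on (UNIV :: 'b set) norm
      in compactin W (W closure_of (T ` unit_ball_on S N)))"


section \<open>Property \<open>(V)\<close> of order \<open>r\<close>\<close>

definition weakly_summable_on ::
    "'a::real_vector set \<Rightarrow> ('a \<Rightarrow> real) \<Rightarrow> real \<Rightarrow> (nat \<Rightarrow> 'a) \<Rightarrow> bool" where
  "weakly_summable_on S N r x \<longleftrightarrow>
     (\<forall>n. x n \<in> S) \<and> (\<forall>f\<in>dual_on S N. summable (\<lambda>n. \<bar>f (x n)\<bar> powr r))"

text \<open>The supremum is taken in \<open>ereal\<close>, where it needs no boundedness assumption.\<close>

definition unconditionally_summable_on ::
    "'a::real_vector set \<Rightarrow> ('a \<Rightarrow> real) \<Rightarrow> real \<Rightarrow> (nat \<Rightarrow> 'a) \<Rightarrow> bool" where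
  "unconditionally_summable_on S N r x \<longleftrightarrow>
     weakly_summable_on S N r x \<and>
     (\<lambda>m. SUP f\<in>dual_unit_ball_on S N.
            ereal ((\<Sum>n. \<bar>f (x (m + n))\<bar> powr r) powr (1 / r))) \<longlonglongrightarrow> 0"

definition unconditionally_converging_on ::
    "'a::real_vector set \<Rightarrow> ('a \<Rightarrow> real) \<Rightarrow> real \<Rightarrow> ('a \<Rightarrow> 'b::real_normed_vector) \<Rightarrow> bool" where
  "unconditionally_converging_on S N r T \<longleftrightarrow>
     bounded_operator_on S N T \<and>
     (\<forall>x. weakly_summable_on S N r x \<longrightarrow>
        unconditionally_summable_on (UNIV :: 'b set) norm r (\<lambda>n. T (x n)))"

text \<open>
  HOL cannot quantify over all Banach spaces inside a formula, so the target space is a type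
  argument; \<open>(S, N)\<close> has the property iff this holds for every type \<open>'b\<close> of class \<open>banach\<close>.
\<close>

definition property_V_on ::
    "'b::banach itself \<Rightarrow> real \<Rightarrow> 'a::real_vector set \<Rightarrow> ('a \<Rightarrow> real) \<Rightarrow> bool" where
  "property_V_on TYPE('b) r S N \<longleftrightarrow>
     (\<forall>T :: 'a \<Rightarrow> 'b. unconditionally_converging_on S N r T \<longrightarrow>
        weakly_compact_operator_on S N T)"


section \<open>James spaces\<close>

instantiation "fun" :: (type, real_vector) real_vector
begin

definition scaleR_fun :: "real \<Rightarrow> ('a \<Rightarrow> 'b) \<Rightarrow> 'a \<Rightarrow> 'b" where
  "scaleR_fun c f = (\<lambda>x. c *\<^sub>R f x)"

instance
  by standard (auto simp: scaleR_fun_def fun_eq_iff scaleR_add_right scaleR_add_left)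

end

text \<open>Sequences are indexed from \<open>0\<close>, so the usual side condition \<open>1 \<le> i 0\<close> disappears.\<close>

definition cyclic_variation :: "real \<Rightarrow> (nat \<Rightarrow> real) \<Rightarrow> (nat \<Rightarrow> nat) \<Rightarrow> nat \<Rightarrow> real" where
  "cyclic_variation p a i m =
     ((\<Sum>j=1..m. \<bar>a (i (j - 1)) - a (i j)\<bar> powr p) + \<bar>a (i m) - a (i 0)\<bar> powr p) powr (1 / p)"

definition cyclic_variations :: "real \<Rightarrow> (nat \<Rightarrow> real) \<Rightarrow> real set" where
  "cyclic_variations p a =
     {cyclic_variation p a i m | i m. 1 \<le> m \<and> strict_mono_on {0..m} i}"

definition cpv_norm :: "real \<Rightarrow> (nat \<Rightarrow> real) \<Rightarrow> real" where
  "cpv_norm p a = 1 / 2 powr (1 / p) * Sup (cyclic_variations p a)"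

definition James_space :: "real \<Rightarrow> (nat \<Rightarrow> real) set" where
  "James_space p = {a. a \<longlonglongrightarrow> 0 \<and> bdd_above (cyclic_variations p a)}"


subsection \<open>The James spaces are Banach spaces\<close>

lemma powr_convex_comb:
  fixes x y t u p :: real
  assumes "1 \<le> p" "0 \<le> x" "0 \<le> y" "0 \<le> t" "0 \<le> u" "t + u = 1"
  shows "(t * x + u * y) powr p \<le> t * x powr p + u * y powr p"
proof -
  have pw: "t powr p \<le> t" "u powr p \<le> u"
    using powr_mono'[of 1 p t] powr_mono'[of 1 p u] assms by auto
  consider "x = 0" | "y = 0" | "0 < x" "0 < y" using assms by linarith
  then show ?thesis
  proof cases
    case 1
    then show ?thesis using assms pw by (auto simp: powr_mult intro: mult_right_mono)
  next
    case 2
    then show ?thesis using assms pw by (auto simp: powr_mult intro: mult_right_mono)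
  next
    case 3
    have "convex_on {0<..} (\<lambda>x::real. x powr p)" using assms(1) by (rule powr_convex)
    then show ?thesis using 3 assms by (auto simp: convex_on_def)
  qed
qed

lemma Minkowski_sum:
  fixes f g :: "'i \<Rightarrow> real"
  assumes p: "1 \<le> p"
  shows "(\<Sum>i\<in>A. \<bar>f i + g i\<bar> powr p) powr (1 / p)
       \<le> (\<Sum>i\<in>A. \<bar>f i\<bar> powr p) powr (1 / p) + (\<Sum>i\<in>A. \<bar>g i\<bar> powr p) powr (1 / p)"
proof (cases "finite A")
  case fin: True
  define F where "F = (\<Sum>i\<in>A. \<bar>f i\<bar> powr p) powr (1 / p)"
  define G where "G = (\<Sum>i\<in>A. \<bar>g i\<bar> powr p) powr (1 / p)"
  have Fp: "F powr p = (\<Sum>i\<in>A. \<bar>f i\<bar> powr p)" and Gp: "G powr p = (\<Sum>i\<in>A. \<bar>g i\<bar> powr p)"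
    using p by (auto simp: F_def G_def powr_powr sum_nonneg)
  have F0: "0 \<le> F" and G0: "0 \<le> G" by (auto simp: F_def G_def)
  consider "F = 0" | "G = 0" | "0 < F" "0 < G" using F0 G0 by linarith
  then have "(\<Sum>i\<in>A. \<bar>f i + g i\<bar> powr p) powr (1 / p) \<le> F + G"
  proof cases
    case 1
    then have "(\<Sum>i\<in>A. \<bar>f i\<bar> powr p) = 0" using Fp p by simp
    then have "f i = 0" if "i \<in> A" for i
      using fin that by (subst (asm) sum_nonneg_eq_0_iff) auto
    then show ?thesis using F0 unfolding G_def by simp
  next
    case 2
    then have "(\<Sum>i\<in>A. \<bar>g i\<bar> powr p) = 0" using Gp p by simp
    then have "g i = 0" if "i \<in> A" for i
      using fin that by (subst (asm) sum_nonneg_eq_0_iff) auto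
    then show ?thesis using G0 unfolding F_def by simp
  next
    case 3
    define s where "s = F + G"
    have s: "0 < s" using 3 by (simp add: s_def)
    have ts: "F / s + G / s = 1" using s by (simp add: s_def flip: add_divide_distrib)
    have *: "\<bar>f i + g i\<bar> powr p \<le>
          s powr p * (F / s * (\<bar>f i\<bar> powr p / F powr p) + G / s * (\<bar>g i\<bar> powr p / G powr p))" for i
    proof -
      have "\<bar>f i + g i\<bar> \<le> s * (F / s * (\<bar>f i\<bar> / F) + G / s * (\<bar>g i\<bar> / G))"
        using 3 s by (simp add: distrib_left abs_triangle_ineq)
      then have "\<bar>f i + g i\<bar> powr p \<le> (s * (F / s * (\<bar>f i\<bar> / F) + G / s * (\<bar>g i\<bar> / G))) powr p"
        using p by (intro powr_mono2) auto
      also have "\<dots> = s powr p * (F / s * (\<bar>f i\<bar> / F) + G / s * (\<bar>g i\<bar> / G)) powr p"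
        using s 3 by (subst powr_mult) auto
      also have "\<dots> \<le> s powr p * (F / s * (\<bar>f i\<bar> / F) powr p + G / s * (\<bar>g i\<bar> / G) powr p)"
        using s 3 p ts by (intro mult_left_mono powr_convex_comb) auto
      finally show ?thesis using 3 by (simp add: powr_divide)
    qed
    have "(\<Sum>i\<in>A. \<bar>f i + g i\<bar> powr p) \<le>
        (\<Sum>i\<in>A. s powr p * (F / s * (\<bar>f i\<bar> powr p / F powr p) + G / s * (\<bar>g i\<bar> powr p / G powr p)))"
      by (intro sum_mono *)
    also have "\<dots> = s powr p * (F / s * ((\<Sum>i\<in>A. \<bar>f i\<bar> powr p) / F powr p)
                 + G / s * ((\<Sum>i\<in>A. \<bar>g i\<bar> powr p) / G powr p))"
      by (simp only: sum_distrib_left[symmetric] sum.distrib sum_divide_distrib[symmetric])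
    also have "\<dots> = s powr p"
      using 3 ts by (simp flip: Fp Gp)
    finally have "(\<Sum>i\<in>A. \<bar>f i + g i\<bar> powr p) powr (1 / p) \<le> (s powr p) powr (1 / p)"
      using p by (intro powr_mono2) (auto simp: sum_nonneg)
    then show ?thesis using s p by (simp add: powr_powr s_def)
  qed
  then show ?thesis by (simp add: F_def G_def)
qed auto

lemma cyclic_variation_conv_sum:
  "cyclic_variation p a i m =
     (\<Sum>j=0..m. \<bar>(if j = 0 then a (i m) - a (i 0) else a (i (j - 1)) - a (i j))\<bar> powr p) powr (1 / p)"
proof -
  have "(\<Sum>j=0..m. \<bar>(if j = 0 then a (i m) - a (i 0) else a (i (j - 1)) - a (i j))\<bar> powr p)
      = \<bar>a (i m) - a (i 0)\<bar> powr p + (\<Sum>j=1..m. \<bar>a (i (j - 1)) - a (i j)\<bar> powr p)"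
    by (subst sum.atLeast_Suc_atMost) (auto intro!: sum.cong)
  then show ?thesis by (simp add: cyclic_variation_def add.commute)
qed

lemma cyclic_variation_nonneg: "0 \<le> cyclic_variation p a i m"
  by (simp add: cyclic_variation_def)

lemma cyclic_variation_add:
  assumes "1 \<le> p"
  shows "cyclic_variation p (a + b) i m \<le> cyclic_variation p a i m + cyclic_variation p b i m"
proof -
  have "cyclic_variation p (a + b) i m =
     (\<Sum>j=0..m. \<bar>(if j = 0 then a (i m) - a (i 0) else a (i (j - 1)) - a (i j)) +
        (if j = 0 then b (i m) - b (i 0) else b (i (j - 1)) - b (i j))\<bar> powr p) powr (1 / p)"
    unfolding cyclic_variation_conv_sum
    by (intro arg_cong2[where f = "(powr)"] sum.cong) (auto simp: algebra_simps)
  also have "\<dots> \<le> cyclic_variation p a i m + cyclic_variation p b i m"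
    unfolding cyclic_variation_conv_sum by (rule Minkowski_sum[OF assms])
  finally show ?thesis .
qed

lemma cyclic_variation_scaleR:
  assumes "1 \<le> p"
  shows "cyclic_variation p (c *\<^sub>R a) i m = \<bar>c\<bar> * cyclic_variation p a i m"
proof -
  have *: "\<bar>c * x - c * y\<bar> powr p = \<bar>c\<bar> powr p * \<bar>x - y\<bar> powr p" for x y :: real
    by (metis abs_mult abs_ge_zero powr_mult right_diff_distrib)
  have "cyclic_variation p (c *\<^sub>R a) i m =
     (\<bar>c\<bar> powr p * ((\<Sum>j=1..m. \<bar>a (i (j - 1)) - a (i j)\<bar> powr p)
        + \<bar>a (i m) - a (i 0)\<bar> powr p)) powr (1 / p)"
    by (simp add: cyclic_variation_def scaleR_fun_def * distrib_left sum_distrib_left)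
  also have "\<dots> = \<bar>c\<bar> * cyclic_variation p a i m"
    using assms by (subst powr_mult) (auto simp: powr_powr cyclic_variation_def sum_nonneg)
  finally show ?thesis .
qed

lemma cyclic_variations_nonempty: "cyclic_variations p a \<noteq> {}"
proof -
  have "strict_mono_on {0..1} (\<lambda>n::nat. n)" by (simp add: strict_mono_on_def)
  then show ?thesis unfolding cyclic_variations_def by blast
qed

lemma cyclic_variation_le_cpv_norm:
  assumes "bdd_above (cyclic_variations p a)" "1 \<le> m" "strict_mono_on {0..m} i"
  shows "cyclic_variation p a i m \<le> 2 powr (1 / p) * cpv_norm p a"
  using assms unfolding cpv_norm_def by (auto simp: cyclic_variations_def intro!: cSup_upper)

lemma cpv_norm_leI:
  assumes "\<And>i m. 1 \<le> m \<Longrightarrow> strict_mono_on {0..m} i \<Longrightarrow> cyclic_variation p a i m \<le> 2 powr (1 / p) * K"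
  shows "cpv_norm p a \<le> K" "bdd_above (cyclic_variations p a)"
proof -
  have "Sup (cyclic_variations p a) \<le> 2 powr (1 / p) * K"
    by (intro cSup_least cyclic_variations_nonempty) (use assms in \<open>auto simp: cyclic_variations_def\<close>)
  then show "cpv_norm p a \<le> K" by (simp add: cpv_norm_def field_simps)
  show "bdd_above (cyclic_variations p a)"
    by (intro bdd_aboveI) (use assms in \<open>auto simp: cyclic_variations_def\<close>)
qed

lemma cpv_norm_nonneg:
  assumes "bdd_above (cyclic_variations p a)" shows "0 \<le> cpv_norm p a"
proof -
  have "strict_mono_on {0..1} (\<lambda>n::nat. n)" by (simp add: strict_mono_on_def)
  from cyclic_variation_le_cpv_norm[OF assms _ this]
  have "0 \<le> 2 powr (1 / p) * cpv_norm p a"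
    using cyclic_variation_nonneg[of p a "\<lambda>n. n" 1] by simp
  then show ?thesis by (simp add: zero_le_mult_iff)
qed

lemma diff_le_cpv_norm:
  assumes "1 \<le> p" "bdd_above (cyclic_variations p a)" "k < l"
  shows "\<bar>a k - a l\<bar> \<le> cpv_norm p a"
proof -
  define i where "i = (\<lambda>n::nat. if n = 0 then k else l)"
  have "strict_mono_on {0..1} i" using assms(3) by (auto simp: strict_mono_on_def i_def)
  from cyclic_variation_le_cpv_norm[OF assms(2) _ this]
  have "cyclic_variation p a i 1 \<le> 2 powr (1 / p) * cpv_norm p a" by simp
  moreover have "cyclic_variation p a i 1 = (2 * \<bar>a k - a l\<bar> powr p) powr (1 / p)"
    by (simp add: cyclic_variation_def i_def abs_minus_commute)
  moreover have "\<dots> = 2 powr (1 / p) * \<bar>a k - a l\<bar>"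
    using assms(1) by (subst powr_mult) (auto simp: powr_powr)
  ultimately show ?thesis by simp
qed

lemma abs_le_cpv_norm:
  assumes "1 \<le> p" "a \<in> James_space p"
  shows "\<bar>a k\<bar> \<le> cpv_norm p a"
proof -
  have a: "a \<longlonglongrightarrow> 0" "bdd_above (cyclic_variations p a)"
    using assms(2) by (auto simp: James_space_def)
  have "(\<lambda>l. \<bar>a k - a l\<bar>) \<longlonglongrightarrow> \<bar>a k - 0\<bar>" by (intro tendsto_intros a)
  then have "\<bar>a k - 0\<bar> \<le> cpv_norm p a"
    by (rule tendsto_upperbound)
       (auto intro!: eventually_mono[OF eventually_gt_at_top[of k]] diff_le_cpv_norm assms a)
  then show ?thesis by simp
qed

lemma cpv_norm_add:
  assumes "1 \<le> p" "bdd_above (cyclic_variations p a)" "bdd_above (cyclic_variations p b)"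
  shows "cpv_norm p (a + b) \<le> cpv_norm p a + cpv_norm p b"
    and "bdd_above (cyclic_variations p (a + b))"
proof -
  have "cyclic_variation p (a + b) i m \<le> 2 powr (1 / p) * (cpv_norm p a + cpv_norm p b)"
    if "1 \<le> m" "strict_mono_on {0..m} i" for i m
    using cyclic_variation_add[OF assms(1), of a b i m]
      cyclic_variation_le_cpv_norm[OF assms(2) that] cyclic_variation_le_cpv_norm[OF assms(3) that]
    by (simp add: distrib_left)
  from cpv_norm_leI(1)[OF this] cpv_norm_leI(2)[OF this]
  show "cpv_norm p (a + b) \<le> cpv_norm p a + cpv_norm p b"
    and "bdd_above (cyclic_variations p (a + b))" by simp_all
qed

lemma cpv_norm_scaleR:
  assumes p: "1 \<le> p" and a: "bdd_above (cyclic_variations p a)"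
  shows "cpv_norm p (c *\<^sub>R a) = \<bar>c\<bar> * cpv_norm p a"
    and "bdd_above (cyclic_variations p (c *\<^sub>R a))"
proof -
  have *: "cpv_norm p (c *\<^sub>R a) \<le> \<bar>c\<bar> * cpv_norm p a \<and> bdd_above (cyclic_variations p (c *\<^sub>R a))"
    if "bdd_above (cyclic_variations p a)" for c a
  proof -
    have "cyclic_variation p (c *\<^sub>R a) i m \<le> 2 powr (1 / p) * (\<bar>c\<bar> * cpv_norm p a)"
      if im: "1 \<le> m" "strict_mono_on {0..m} i" for i m
      using mult_left_mono[OF cyclic_variation_le_cpv_norm[OF \<open>bdd_above (cyclic_variations p a)\<close> im], of "\<bar>c\<bar>"]
      by (simp add: cyclic_variation_scaleR[OF p] algebra_simps)
    from cpv_norm_leI(1)[OF this] cpv_norm_leI(2)[OF this] show ?thesis by simp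
  qed
  show bdd: "bdd_above (cyclic_variations p (c *\<^sub>R a))" using *[OF a, of c] by simp
  have "\<bar>c\<bar> * cpv_norm p a \<le> cpv_norm p (c *\<^sub>R a)"
  proof (cases "c = 0")
    case True
    then show ?thesis using cpv_norm_nonneg[OF bdd] by simp
  next
    case False
    then have "cpv_norm p a \<le> \<bar>inverse c\<bar> * cpv_norm p (c *\<^sub>R a)"
      using *[OF bdd, of "inverse c"] by simp
    then show ?thesis using False by (simp add: field_simps)
  qed
  then show "cpv_norm p (c *\<^sub>R a) = \<bar>c\<bar> * cpv_norm p a" using *[OF a, of c] by simp
qed

lemma subspace_James_space:
  assumes "1 \<le> p" shows "subspace (James_space p)"
proof (rule subspaceI)
  show "0 \<in> James_space p"
    unfolding James_space_def
    by (auto simp: zero_fun_def cyclic_variation_def intro!: cpv_norm_leI(2)[of _ _ 0])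
next
  fix x y assume "x \<in> James_space p" "y \<in> James_space p"
  then show "x + y \<in> James_space p"
    using cpv_norm_add(2)[OF assms] tendsto_add[of x 0 sequentially y 0]
    by (auto simp: James_space_def plus_fun_def)
next
  fix c :: real and x assume "x \<in> James_space p"
  then show "c *\<^sub>R x \<in> James_space p"
    using cpv_norm_scaleR(2)[OF assms] tendsto_mult_left[of x 0 sequentially c]
    by (auto simp: James_space_def scaleR_fun_def)
qed

lemma James_space_complete:
  assumes p: "1 \<le> p" and X: "\<And>n. X n \<in> James_space p"
    and Cauchy: "\<And>e. 0 < e \<Longrightarrow> \<exists>M. \<forall>m\<ge>M. \<forall>n\<ge>M. cpv_norm p (X m - X n) < e"
  shows "\<exists>a\<in>James_space p. (\<lambda>n. cpv_norm p (X n - a)) \<longlonglongrightarrow> 0"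
proof -
  have sub: "subspace (James_space p)" using p by (rule subspace_James_space)
  have diff: "X m - X n \<in> James_space p" for m n by (intro subspace_diff sub X)
  have "Cauchy (\<lambda>n. X n k)" for k
  proof (rule metric_CauchyI)
    fix e :: real assume "0 < e"
    from Cauchy[OF this] obtain M where M: "\<forall>m\<ge>M. \<forall>n\<ge>M. cpv_norm p (X m - X n) < e" by blast
    have "dist (X m k) (X n k) < e" if "m \<ge> M" "n \<ge> M" for m n
      using abs_le_cpv_norm[OF p diff[of m n], of k] M that by (force simp: dist_real_def)
    then show "\<exists>M. \<forall>m\<ge>M. \<forall>n\<ge>M. dist (X m k) (X n k) < e" by blast
  qed
  then have "\<forall>k. \<exists>l. (\<lambda>n. X n k) \<longlonglongrightarrow> l" by (simp add: Cauchy_convergent_iff convergent_def)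
  then obtain a where a: "\<And>k. (\<lambda>n. X n k) \<longlonglongrightarrow> a k" by metis
  have close: "\<exists>M. \<forall>n\<ge>M. (\<forall>k. \<bar>X n k - a k\<bar> \<le> e) \<and> cpv_norm p (X n - a) \<le> e \<and>
                bdd_above (cyclic_variations p (X n - a))" if "0 < e" for e
  proof -
    from Cauchy[OF that] obtain M where M: "\<forall>m\<ge>M. \<forall>n\<ge>M. cpv_norm p (X m - X n) < e" by blast
    have "(\<forall>k. \<bar>X n k - a k\<bar> \<le> e) \<and> cpv_norm p (X n - a) \<le> e \<and>
        bdd_above (cyclic_variations p (X n - a))" if n: "n \<ge> M" for n
    proof -
      have "\<bar>X n k - a k\<bar> \<le> e" for k
      proof (rule tendsto_upperbound)
        show "(\<lambda>l. \<bar>X n k - X l k\<bar>) \<longlonglongrightarrow> \<bar>X n k - a k\<bar>" by (intro tendsto_intros a)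
        have "\<bar>X n k - X l k\<bar> \<le> e" if "l \<ge> M" for l
          using abs_le_cpv_norm[OF p diff[of n l], of k] M n that by force
        then show "\<forall>\<^sub>F l in sequentially. \<bar>X n k - X l k\<bar> \<le> e"
          by (auto simp: eventually_sequentially)
      qed auto
      moreover have "cyclic_variation p (X n - a) i m \<le> 2 powr (1 / p) * e"
        if im: "1 \<le> m" "strict_mono_on {0..m} i" for i m
      proof (rule tendsto_upperbound)
        have pw: "((\<lambda>x. g x powr q) \<longlongrightarrow> L powr q) sequentially"
          if "(g \<longlongrightarrow> L) sequentially" "0 < q" "\<And>x. 0 \<le> g x" for g :: "nat \<Rightarrow> real" and L q
          using that by (intro tendsto_powr2) auto
        show "(\<lambda>l. cyclic_variation p (X n - X l) i m) \<longlonglongrightarrow> cyclic_variation p (X n - a) i m"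
          unfolding cyclic_variation_def fun_diff_def
          using p by (intro pw tendsto_add tendsto_sum tendsto_rabs tendsto_diff tendsto_const a)
                     (auto intro!: add_nonneg_nonneg sum_nonneg)
        have "cyclic_variation p (X n - X l) i m \<le> 2 powr (1 / p) * e" if "l \<ge> M" for l
        proof -
          have "cyclic_variation p (X n - X l) i m \<le> 2 powr (1 / p) * cpv_norm p (X n - X l)"
            using diff[of n l] im by (intro cyclic_variation_le_cpv_norm) (auto simp: James_space_def)
          also have "\<dots> \<le> 2 powr (1 / p) * e"
            using M n that by (intro mult_left_mono) (auto intro: less_imp_le)
          finally show ?thesis .
        qed
        then show "\<forall>\<^sub>F l in sequentially. cyclic_variation p (X n - X l) i m \<le> 2 powr (1 / p) * e"
          by (auto simp: eventually_sequentially)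
      qed auto
      from cpv_norm_leI(1)[OF this] cpv_norm_leI(2)[OF this] have "cpv_norm p (X n - a) \<le> e"
        "bdd_above (cyclic_variations p (X n - a))" by simp_all
      ultimately show ?thesis by blast
    qed
    then show ?thesis by blast
  qed
  have "a \<longlonglongrightarrow> 0"
  proof (rule LIMSEQ_I)
    fix e :: real assume e: "0 < e"
    from close[of "e / 2"] e obtain n where n: "\<forall>k. \<bar>X n k - a k\<bar> \<le> e / 2" by auto
    have "X n \<longlonglongrightarrow> 0" using X by (auto simp: James_space_def)
    then obtain K where K: "\<forall>k\<ge>K. norm (X n k - 0) < e / 2"
      using LIMSEQ_D[of "X n" 0 "e / 2"] e by auto
    have "norm (a k - 0) < e" if "k \<ge> K" for k
      using n[rule_format, of k] K[rule_format, OF that]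
      by (simp add: abs_if split: if_splits)
    then show "\<exists>K. \<forall>k\<ge>K. norm (a k - 0) < e" by blast
  qed
  moreover obtain n where "bdd_above (cyclic_variations p (X n - a))"
    using close[of 1] by auto
  then have "bdd_above (cyclic_variations p (X n + (-1) *\<^sub>R (X n - a)))"
    using X by (intro cpv_norm_add cpv_norm_scaleR p) (auto simp: James_space_def)
  then have "bdd_above (cyclic_variations p a)" by simp
  ultimately have aJ: "a \<in> James_space p" by (simp add: James_space_def)
  have "(\<lambda>n. cpv_norm p (X n - a)) \<longlonglongrightarrow> 0"
  proof (rule LIMSEQ_I)
    fix e :: real assume e: "0 < e"
    obtain M where M: "\<forall>n\<ge>M. (\<forall>k. \<bar>X n k - a k\<bar> \<le> e / 2) \<and> cpv_norm p (X n - a) \<le> e / 2 \<and>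
        bdd_above (cyclic_variations p (X n - a))" using close[OF half_gt_zero[OF e]] ..
    have "norm (cpv_norm p (X n - a) - 0) < e" if "n \<ge> M" for n
      using M[rule_format, OF that] cpv_norm_nonneg[of p "X n - a"] e by auto
    then show "\<exists>M. \<forall>n\<ge>M. norm (cpv_norm p (X n - a) - 0) < e" by blast
  qed
  with aJ show ?thesis by blast
qed

theorem banach_space_on_James_space:
  assumes "1 < p"
  shows "banach_space_on (James_space p) (cpv_norm p)"
proof -
  have p: "1 \<le> p" using assms by simp
  have "x = 0" if "x \<in> James_space p" "cpv_norm p x = 0" for x
    using abs_le_cpv_norm[OF p that(1)] that(2) by (auto simp: fun_eq_iff)
  then show ?thesis
    unfolding banach_space_on_def
    using p subspace_James_space[OF p] James_space_complete[OF p]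
    by (auto simp: James_space_def intro!: cpv_norm_nonneg cpv_norm_scaleR cpv_norm_add)
qed

end

theory Submission
  imports Defs
begin

text \<open>
  An unconditionally \<open>q\<close>-converging operator \<open>T\<close> on \<open>J\<^sub>p\<close> is even compact. The reason is an upper
  \<open>p\<close>-estimate: if bounded sequences \<open>y 0, y 1, \<dots>\<close> in \<open>J\<^sub>p\<close> have pairwise disjoint supports, then
  \<open>\<parallel>\<Sum>k. c k y k\<parallel> \<le> C (\<Sum>k. \<bar>c k\<bar> powr p) powr (1 / p)\<close>, because each difference of two entries of the
  combination involves at most two of the \<open>y k\<close> (\<open>upper_p_estimate\<close>). By duality such a sequence is
  weakly \<open>q\<close>-summable (\<open>disjoint_weakly_summable\<close>). So \<open>T\<close> maps it to an unconditionally
  \<open>q\<close>-summable sequence, whose terms tend to zero in norm; this last point needs norming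
  functionals, that is, a form of the Hahn--Banach theorem (\<open>norming_functional\<close>).

  Every \<open>x\<close> in \<open>J\<^sub>p\<close> is approximated by its finite truncations (\<open>tail_tendsto_0\<close>). A gliding hump
  argument then shows that the approximation of \<open>T x\<close> by \<open>T\<close> of a truncation is uniform over the
  unit ball: otherwise disjoint blocks could be cut out of vectors of the ball on which \<open>T\<close> is
  bounded away from zero (\<open>uniformly_small_tails\<close>). Hence \<open>T\<close> is a limit of finite rank operators,
  and the image of the unit ball has norm compact closure. Since the weak topology is coarser than
  the norm topology and Hausdorff, this closure also contains the weak closure of the image, which
  is therefore weakly compact.
\<close>

section \<open>Norming functionals\<close>

text \<open>
  A norming functional is found as a minimal element among the sublinear functionals below the
  norm. Only half of homogeneity is required because \<open>c\<close> may be replaced by its inverse.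
\<close>

definition sublinear :: "('a::real_vector \<Rightarrow> real) \<Rightarrow> bool" where
  "sublinear f \<longleftrightarrow>
     (\<forall>x y. f (x + y) \<le> f x + f y) \<and> (\<forall>c>0. \<forall>x. f (c *\<^sub>R x) \<le> c * f x)"

lemma sublinear_scaleR:
  assumes "sublinear f" "0 < c"
  shows "f (c *\<^sub>R x) = c * f x"
proof -
  have "f (inverse c *\<^sub>R (c *\<^sub>R x)) \<le> inverse c * f (c *\<^sub>R x)"
    using assms unfolding sublinear_def by (metis positive_imp_inverse_positive)
  then have "c * f x \<le> f (c *\<^sub>R x)" using assms(2) by (simp add: field_simps)
  moreover have "f (c *\<^sub>R x) \<le> c * f x" using assms unfolding sublinear_def by blast
  ultimately show ?thesis by simp
qed

lemma sublinear_0: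
  assumes "sublinear f" shows "f 0 = 0"
  using sublinear_scaleR[OF assms, of 2 0] by simp

lemma sublinear_lower:
  assumes "sublinear f" shows "- f (- x) \<le> f x"
proof -
  have "f (x + - x) \<le> f x + f (- x)" using assms unfolding sublinear_def by blast
  then show ?thesis using sublinear_0[OF assms] by simp
qed

text \<open>
  Lowering \<open>f\<close> as far as possible in the direction \<open>- y\<close>: the result is still sublinear, lies below
  \<open>f\<close>, and takes at \<open>- y\<close> at most the value \<open>- f y\<close> that linearity would force.
\<close>

definition tilt :: "'a::real_vector \<Rightarrow> ('a \<Rightarrow> real) \<Rightarrow> 'a \<Rightarrow> real" where
  "tilt y f x = (INF t\<in>{0..}. f (x + t *\<^sub>R y) - t * f y)"

lemma tilt_le:
  assumes f: "sublinear f" and t: "0 \<le> t"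
  shows "tilt y f x \<le> f (x + t *\<^sub>R y) - t * f y"
  unfolding tilt_def
proof (rule cINF_lower)
  have "- f (- x) \<le> f (x + s *\<^sub>R y) - s * f y" if "0 \<le> s" for s
  proof -
    have "s * f y = f (s *\<^sub>R y)"
      using that sublinear_scaleR[OF f, of s y] sublinear_0[OF f] by (cases "s = 0") auto
    also have "\<dots> = f ((x + s *\<^sub>R y) + (- x))" by simp
    also have "\<dots> \<le> f (x + s *\<^sub>R y) + f (- x)" using f unfolding sublinear_def by blast
    finally show ?thesis by simp
  qed
  then show "bdd_below ((\<lambda>t. f (x + t *\<^sub>R y) - t * f y) ` {0..})"
    by (intro bdd_belowI2[where m = "- f (- x)"]) auto
qed (use t in simp)

lemma le_tilt:
  assumes "\<And>t. 0 \<le> t \<Longrightarrow> b \<le> f (x + t *\<^sub>R y) - t * f y"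
  shows "b \<le> tilt y f x"
  unfolding tilt_def by (rule cINF_greatest) (use assms in auto)

lemma tilt_le_self: "sublinear f \<Longrightarrow> tilt y f x \<le> f x"
  using tilt_le[of f 0 y x] by simp

lemma tilt_uminus: "sublinear f \<Longrightarrow> tilt y f (- y) \<le> - f y"
  using tilt_le[of f 1 y "- y"] sublinear_0[of f] by simp

lemma sublinear_tilt:
  assumes f: "sublinear f"
  shows "sublinear (tilt y f)"
  unfolding sublinear_def
proof (intro conjI allI impI)
  fix x z
  have *: "tilt y f (x + z) \<le> (f (x + s *\<^sub>R y) - s * f y) + (f (z + t *\<^sub>R y) - t * f y)"
    if "0 \<le> s" "0 \<le> t" for s t
  proof -
    have "tilt y f (x + z) \<le> f ((x + z) + (s + t) *\<^sub>R y) - (s + t) * f y"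
      using that by (intro tilt_le f) auto
    also have "(x + z) + (s + t) *\<^sub>R y = (x + s *\<^sub>R y) + (z + t *\<^sub>R y)"
      by (simp add: algebra_simps)
    also have "f \<dots> \<le> f (x + s *\<^sub>R y) + f (z + t *\<^sub>R y)"
      using f unfolding sublinear_def by blast
    finally show ?thesis by (simp add: algebra_simps)
  qed
  have "tilt y f (x + z) - tilt y f x \<le> f (z + t *\<^sub>R y) - t * f y" if "0 \<le> t" for t
    using le_tilt[of "tilt y f (x + z) - (f (z + t *\<^sub>R y) - t * f y)" f x y] * that
    by (force simp: algebra_simps)
  from le_tilt[OF this] show "tilt y f (x + z) \<le> tilt y f x + tilt y f z" by simp
next
  fix c :: real and x assume c: "0 < c"
  have "tilt y f (c *\<^sub>R x) / c \<le> f (x + t *\<^sub>R y) - t * f y" if "0 \<le> t" for t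
  proof -
    have "tilt y f (c *\<^sub>R x) \<le> f (c *\<^sub>R x + (c * t) *\<^sub>R y) - (c * t) * f y"
      using that c by (intro tilt_le f) auto
    also have "c *\<^sub>R x + (c * t) *\<^sub>R y = c *\<^sub>R (x + t *\<^sub>R y)" by (simp add: algebra_simps)
    also have "f \<dots> = c * f (x + t *\<^sub>R y)" using sublinear_scaleR[OF f c] .
    finally show ?thesis using c by (simp add: field_simps)
  qed
  from le_tilt[OF this] show "tilt y f (c *\<^sub>R x) \<le> c * tilt y f x"
    using c by (simp add: field_simps)
qed

text \<open>Zorn's lemma applies because the pointwise infimum of a chain of sublinear functionals is
  sublinear: two values are always estimated by the smaller of two members of the chain.\<close>

lemma minimal_sublinear:
  fixes f0 :: "'a::real_vector \<Rightarrow> real"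
  assumes f0: "sublinear f0"
  shows "\<exists>f. sublinear f \<and> f \<le> f0 \<and> (\<forall>g. sublinear g \<and> g \<le> f \<longrightarrow> g = f)"
proof -
  define A where "A = {f. sublinear f \<and> f \<le> f0}"
  define R where "R = (\<lambda>f g :: 'a \<Rightarrow> real. g \<le> f)"
  have "\<exists>m\<in>A. \<forall>a\<in>A. R m a \<longrightarrow> a = m"
  proof (rule predicate_Zorn)
    show "partial_order_on A (relation_of R A)"
      by (auto simp: partial_order_on_def preorder_on_def refl_on_def trans_def antisym_def
          relation_of_def R_def)
    fix C assume C: "C \<in> Chains (relation_of R A)"
    then have CA: "C \<subseteq> A" and total: "\<And>f g. f \<in> C \<Longrightarrow> g \<in> C \<Longrightarrow> f \<le> g \<or> g \<le> f"
      unfolding Chains_def relation_of_def R_def by auto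
    show "\<exists>u\<in>A. \<forall>a\<in>C. R a u"
    proof (cases "C = {}")
      case True
      then show ?thesis using f0 unfolding A_def by auto
    next
      case False
      define u where "u = (\<lambda>x. INF f\<in>C. f x)"
      have sub: "sublinear f" if "f \<in> C" for f using CA that unfolding A_def by auto
      have u_le: "u x \<le> f x" if "f \<in> C" for f x
        unfolding u_def
      proof (rule cINF_lower[OF _ that])
        have "- f0 (- x) \<le> g x" if "g \<in> C" for g
        proof -
          have "g \<le> f0" using CA that unfolding A_def by auto
          then have "g (- x) \<le> f0 (- x)" by (rule le_funD)
          then show ?thesis using sublinear_lower[OF sub[OF that], of x] by simp
        qed
        then show "bdd_below ((\<lambda>f. f x) ` C)" by (intro bdd_belowI2) auto
      qed
      have le_u: "b \<le> u x" if "\<And>f. f \<in> C \<Longrightarrow> b \<le> f x" for b x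
        unfolding u_def by (rule cINF_greatest) (use False that in auto)
      have "sublinear u"
        unfolding sublinear_def
      proof (intro conjI allI impI)
        fix x y
        have *: "u (x + y) \<le> f x + g y" if "f \<in> C" "g \<in> C" for f g
        proof -
          have add: "u (x + y) \<le> h x + h y" if "h \<in> C" for h
            using u_le[OF that, of "x + y"] sub[OF that] unfolding sublinear_def
            by (meson order_trans)
          from total[OF that] show ?thesis
          proof
            assume "f \<le> g"
            then show ?thesis using add[OF that(1)] le_funD[of f g y] by simp
          next
            assume "g \<le> f"
            then show ?thesis using add[OF that(2)] le_funD[of g f x] by simp
          qed
        qed
        have "u (x + y) - u x \<le> u y"
        proof (rule le_u)
          fix g assume g: "g \<in> C"
          have "u (x + y) - g y \<le> u x"
            by (rule le_u) (use *[OF _ g] in \<open>simp add: algebra_simps\<close>)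
          then show "u (x + y) - u x \<le> g y" by simp
        qed
        then show "u (x + y) \<le> u x + u y" by simp
      next
        fix c :: real and x assume c: "0 < c"
        have "u (c *\<^sub>R x) / c \<le> u x"
        proof (rule le_u)
          fix f assume f: "f \<in> C"
          show "u (c *\<^sub>R x) / c \<le> f x"
            using u_le[OF f, of "c *\<^sub>R x"] sublinear_scaleR[OF sub[OF f] c, of x] c
            by (simp add: field_simps)
        qed
        then show "u (c *\<^sub>R x) \<le> c * u x" using c by (simp add: field_simps)
      qed
      moreover obtain f where "f \<in> C" using False by blast
      then have "u \<le> f0" using u_le CA unfolding A_def le_fun_def by (force intro: order_trans)
      ultimately show ?thesis using u_le by (auto simp: A_def R_def le_fun_def)
    qed
  qed
  then obtain f where f: "sublinear f" "f \<le> f0" "\<And>g. g \<in> A \<Longrightarrow> g \<le> f \<Longrightarrow> g = f"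
    unfolding A_def R_def by blast
  then have "g = f" if "sublinear g" "g \<le> f" for g
    using that by (auto simp: A_def intro: order_trans)
  with f(1,2) show ?thesis by blast
qed

text \<open>A minimal functional equals all its tilts, hence is odd; subadditivity then works both ways.\<close>

lemma minimal_sublinear_linear:
  assumes f: "sublinear f" and min: "\<And>g. sublinear g \<Longrightarrow> g \<le> f \<Longrightarrow> g = f"
  shows "linear f"
proof -
  have odd: "f (- y) = - f y" for y
  proof -
    have "tilt y f = f"
      using f by (intro min sublinear_tilt) (auto simp: le_fun_def tilt_le_self)
    then have "f (- y) \<le> - f y" using tilt_uminus[OF f, of y] by simp
    then show ?thesis using sublinear_lower[OF f, of y] by simp
  qed
  have sub: "f (x + y) \<le> f x + f y" for x y using f unfolding sublinear_def by blast
  show ?thesis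
  proof (rule linearI)
    fix x y
    show "f (x + y) = f x + f y" using sub[of x y] sub[of "x + y" "- y"] odd[of y] by simp
  next
    fix c :: real and x
    consider "0 < c" | "c = 0" | "0 < - c" by linarith
    then show "f (c *\<^sub>R x) = c *\<^sub>R f x"
    proof cases
      case 3
      then have "f ((- c) *\<^sub>R x) = (- c) * f x" using sublinear_scaleR[OF f] by blast
      then show ?thesis using odd[of "c *\<^sub>R x"] by simp
    qed (use sublinear_scaleR[OF f] sublinear_0[OF f] in auto)
  qed
qed

text \<open>The Hahn--Banach theorem in the form that is needed: start from the norm tilted towards \<open>y\<close>.\<close>

lemma norming_functional:
  fixes y :: "'a::real_normed_vector"
  shows "\<exists>f. linear f \<and> (\<forall>x. \<bar>f x\<bar> \<le> norm x) \<and> f y = norm y"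
proof -
  have N: "sublinear (norm :: 'a \<Rightarrow> real)"
    unfolding sublinear_def by (auto simp: norm_triangle_ineq)
  from minimal_sublinear[OF sublinear_tilt[OF N, of y]] obtain f
    where f: "sublinear f" "f \<le> tilt y norm" "\<And>g. sublinear g \<Longrightarrow> g \<le> f \<Longrightarrow> g = f"
    by blast
  have lin: "linear f" using minimal_sublinear_linear[OF f(1,3)] .
  have le: "f x \<le> norm x" for x
    using f(2) tilt_le_self[OF N, of y x] by (auto simp: le_fun_def intro: order_trans)
  have "\<bar>f x\<bar> \<le> norm x" for x
    using le[of x] le[of "- x"] linear_neg[OF lin, of x] by simp
  moreover have "f (- y) \<le> - norm y"
    using f(2) tilt_uminus[OF N, of y] by (auto simp: le_fun_def intro: order_trans)
  then have "f y = norm y" using le[of y] linear_neg[OF lin, of y] by simp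
  ultimately show ?thesis using lin by blast
qed

section \<open>Weak compactness and weak summability\<close>

lemma dual_on_UNIV_iff: "f \<in> dual_on UNIV norm \<longleftrightarrow> bounded_linear f"
  unfolding dual_on_def bounded_operator_on_def bounded_linear_def bounded_linear_axioms_def
    linear_iff by (auto simp: mult.commute)

lemma topspace_weak_topology:
  "topspace (weak_topology_on (UNIV :: 'a::real_normed_vector set) norm) = UNIV"
proof -
  have "(\<lambda>x::'a. 0) \<in> dual_on UNIV norm" unfolding dual_on_UNIV_iff by (rule bounded_linear_zero)
  then have "(UNIV :: 'a set) \<in> {{x\<in>UNIV. f x \<in> U} | f U. f \<in> dual_on UNIV norm \<and> open U}"
    by (auto intro!: exI[of _ "\<lambda>x. 0"] exI[of _ UNIV])
  then show ?thesis unfolding weak_topology_on_def topology_generated_by_topspace by blast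
qed

lemma openin_weak_topology:
  fixes f :: "'a::real_normed_vector \<Rightarrow> real"
  assumes "bounded_linear f" "open U"
  shows "openin (weak_topology_on UNIV norm) {x. f x \<in> U}"
  unfolding weak_topology_on_def
  by (rule topology_generated_by_Basis) (use assms in \<open>auto simp: dual_on_UNIV_iff\<close>)

lemma Hausdorff_weak_topology:
  "Hausdorff_space (weak_topology_on (UNIV :: 'a::real_normed_vector set) norm)"
  unfolding Hausdorff_space_def
proof (intro allI impI, elim conjE)
  fix x y :: 'a assume "x \<noteq> y"
  obtain f where f: "linear f" "\<And>z. \<bar>f z\<bar> \<le> norm z" "f (x - y) = norm (x - y)"
    using norming_functional by blast
  have bl: "bounded_linear f"
    by (rule bounded_linear_intro[where K = 1]) (use f(1,2) in \<open>auto simp: linear_add linear_scale\<close>)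
  have "0 < norm (x - y)" using \<open>x \<noteq> y\<close> by simp
  then have "f y < f x" using f(3) linear_diff[OF f(1), of x y] by linarith
  then obtain c where c: "f y < c" "c < f x" using dense by blast
  have "openin (weak_topology_on UNIV norm) {z. f z \<in> {c<..}}"
    and "openin (weak_topology_on UNIV norm) {z. f z \<in> {..<c}}"
    by (intro openin_weak_topology bl open_greaterThan open_lessThan)+
  moreover have "x \<in> {z. f z \<in> {c<..}}" "y \<in> {z. f z \<in> {..<c}}" using c by auto
  moreover have "disjnt {z. f z \<in> {c<..}} {z. f z \<in> {..<c}}" by (auto simp: disjnt_def)
  ultimately show "\<exists>U V. openin (weak_topology_on UNIV norm) U \<and> openin (weak_topology_on UNIV norm) V \<and>
      x \<in> U \<and> y \<in> V \<and> disjnt U V"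
    by blast
qed

lemma compactin_weak_topology:
  fixes K :: "'a::real_normed_vector set"
  assumes "compact K"
  shows "compactin (weak_topology_on UNIV norm) K"
proof -
  have "continuous_map euclidean (weak_topology_on (UNIV :: 'a set) norm) (\<lambda>x. x)"
    unfolding weak_topology_on_def
  proof (rule continuous_on_generated_topo)
    fix U :: "'a set"
    assume "U \<in> {{x \<in> UNIV. f x \<in> U} | f U. f \<in> dual_on UNIV norm \<and> open U}"
    then obtain f V where U: "U = {x. f x \<in> V}" and "f \<in> dual_on UNIV norm" "open V"
      by (elim CollectE exE conjE) simp
    then have "bounded_linear f" "open V" by (simp_all add: dual_on_UNIV_iff)
    then have "open (f -` V)" by (metis open_vimage linear_continuous_on)
    then show "openin euclidean ((\<lambda>x. x) -` U \<inter> topspace euclidean)"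
      by (simp add: U vimage_def)
  next
    show "(\<lambda>x. x) ` topspace euclidean
        \<subseteq> \<Union> {{x \<in> UNIV. f x \<in> U} | f U. f \<in> dual_on (UNIV :: 'a set) norm \<and> open U}"
      using topspace_weak_topology[where 'a = 'a]
      unfolding weak_topology_on_def topology_generated_by_topspace by simp
  qed
  from image_compactin[OF _ this, of K] assms show ?thesis by simp
qed

text \<open>The weak closure of the image stays inside \<open>K\<close>: a norm compact set is weakly compact, hence
  weakly closed because the weak topology is Hausdorff.\<close>

lemma compact_operator_imp_weakly_compact:
  fixes T :: "'a::real_vector \<Rightarrow> 'b::real_normed_vector"
  assumes T: "bounded_operator_on S N T" and K: "compact K" "T ` unit_ball_on S N \<subseteq> K"
  shows "weakly_compact_operator_on S N T"
proof -
  define W where "W = weak_topology_on (UNIV :: 'b set) norm"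
  have cW: "compactin W K" using K(1) unfolding W_def by (rule compactin_weak_topology)
  then have "closedin W K"
    unfolding W_def by (intro compactin_imp_closedin Hausdorff_weak_topology)
  then have "W closure_of (T ` unit_ball_on S N) \<subseteq> K" using K(2) by (intro closure_of_minimal)
  then have "compactin W (W closure_of (T ` unit_ball_on S N))"
    using cW closed_compactin closedin_closure_of by blast
  then show ?thesis using T unfolding weakly_compact_operator_on_def W_def Let_def by blast
qed

text \<open>A functional that norms \<open>y m\<close> shows that \<open>norm (y m)\<close> is at most the \<open>m\<close>-th tail supremum.\<close>

lemma unconditionally_summable_norm_tendsto_0:
  fixes y :: "nat \<Rightarrow> 'b::real_normed_vector"
  assumes r: "1 \<le> r" and y: "unconditionally_summable_on UNIV norm r y"
  shows "(\<lambda>n. norm (y n)) \<longlonglongrightarrow> 0"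
proof -
  define s where "s = (\<lambda>m. SUP f\<in>dual_unit_ball_on (UNIV :: 'b set) norm.
            ereal ((\<Sum>n. \<bar>f (y (m + n))\<bar> powr r) powr (1 / r)))"
  have ws: "weakly_summable_on UNIV norm r y" and s0: "s \<longlonglongrightarrow> 0"
    using y unfolding unconditionally_summable_on_def s_def by auto
  have "ereal (norm (y m)) \<le> s m" for m
  proof -
    obtain f where f: "linear f" "\<And>z. \<bar>f z\<bar> \<le> norm z" "f (y m) = norm (y m)"
      using norming_functional by blast
    have bl: "bounded_linear f"
      by (rule bounded_linear_intro[where K = 1]) (use f(1,2) in \<open>auto simp: linear_add linear_scale\<close>)
    then have fd: "f \<in> dual_on UNIV norm" by (simp add: dual_on_UNIV_iff)
    have "dual_norm_on UNIV norm f \<le> 1"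
      unfolding dual_norm_on_def
      by (rule cSUP_least) (use f(2) in \<open>auto simp: unit_ball_on_def intro: order_trans exI[of _ 0]\<close>)
    then have fb: "f \<in> dual_unit_ball_on UNIV norm" using fd by (simp add: dual_unit_ball_on_def)
    have "summable (\<lambda>n. \<bar>f (y n)\<bar> powr r)" using ws fd unfolding weakly_summable_on_def by blast
    then have sm: "summable (\<lambda>n. \<bar>f (y (m + n))\<bar> powr r)"
      using summable_iff_shift[of "\<lambda>n. \<bar>f (y n)\<bar> powr r" m] by (simp add: add.commute)
    have "\<bar>f (y m)\<bar> powr r \<le> (\<Sum>n. \<bar>f (y (m + n))\<bar> powr r)"
      using sum_le_suminf[OF sm, of "{0}"] by simp
    then have "(\<bar>f (y m)\<bar> powr r) powr (1 / r) \<le> (\<Sum>n. \<bar>f (y (m + n))\<bar> powr r) powr (1 / r)"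
      using r by (intro powr_mono2) auto
    then have "ereal (norm (y m)) \<le> ereal ((\<Sum>n. \<bar>f (y (m + n))\<bar> powr r) powr (1 / r))"
      using f(3) r by (simp add: powr_powr)
    also have "\<dots> \<le> s m" unfolding s_def using fb by (rule SUP_upper)
    finally show ?thesis .
  qed
  then have "(\<lambda>m. ereal (norm (y m))) \<longlonglongrightarrow> 0"
    by (intro tendsto_sandwich[OF _ _ tendsto_const s0]) auto
  then show ?thesis by (simp add: zero_ereal_def)
qed


section \<open>Finite linear combinations\<close>

lemma bounded_operator_on_sum:
  fixes n :: nat
  assumes T: "bounded_operator_on S \<nu> T" and S: "subspace S" and x: "\<And>k. x k \<in> S"
  shows "T (\<Sum>k<n. c k *\<^sub>R x k) = (\<Sum>k<n. c k *\<^sub>R T (x k))"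
proof (induct n)
  case 0
  have "T (0 *\<^sub>R 0) = 0 *\<^sub>R T 0"
    using T subspace_0[OF S] unfolding bounded_operator_on_def by blast
  then show ?case by simp
next
  case (Suc n)
  have "(\<Sum>k<n. c k *\<^sub>R x k) \<in> S" "c n *\<^sub>R x n \<in> S"
    using x S by (auto intro!: subspace_sum subspace_scale)
  then show ?case using Suc T x unfolding bounded_operator_on_def by simp
qed

lemma bounded_operator_on_diff:
  assumes T: "bounded_operator_on S \<nu> T" and S: "subspace S" and x: "x \<in> S" "y \<in> S"
  shows "T (x - y) = T x - T y"
proof -
  have "T (x + (-1) *\<^sub>R y) = T x + T ((-1) *\<^sub>R y)" "T ((-1) *\<^sub>R y) = (-1) *\<^sub>R T y"
    using T x subspace_scale[OF S x(2), of "-1"] unfolding bounded_operator_on_def by blast+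
  then show ?thesis by simp
qed

text \<open>This compact set will contain the images of all truncated vectors of the unit ball.\<close>

lemma compact_bounded_combinations:
  fixes b :: "nat \<Rightarrow> 'b::real_normed_vector"
  shows "compact {\<Sum>k<m. c k *\<^sub>R b k | c. \<forall>k. \<bar>c k\<bar> \<le> 1}"
proof (induction m)
  case 0
  have "\<exists>c :: nat \<Rightarrow> real. \<forall>k. \<bar>c k\<bar> \<le> 1" by (rule exI[of _ "\<lambda>_. 0"]) simp
  then show ?case by simp
next
  case (Suc m)
  let ?P = "\<lambda>m. {\<Sum>k<m. c k *\<^sub>R b k | c. \<forall>k. \<bar>c k\<bar> \<le> 1}"
  let ?I = "(\<lambda>t. t *\<^sub>R b m) ` {-1..1}"
  have "?P (Suc m) = {v + w | v w. v \<in> ?P m \<and> w \<in> ?I}"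
  proof (intro equalityI subsetI)
    fix z assume "z \<in> {v + w | v w. v \<in> ?P m \<and> w \<in> ?I}"
    then obtain c t where c: "\<forall>k. \<bar>c k\<bar> \<le> 1" "-1 \<le> t" "t \<le> 1"
      and z: "z = (\<Sum>k<m. c k *\<^sub>R b k) + t *\<^sub>R b m" by auto
    have "z = (\<Sum>k<Suc m. (c(m := t)) k *\<^sub>R b k)" by (simp add: z)
    moreover have "\<forall>k. \<bar>(c(m := t)) k\<bar> \<le> 1" using c by (simp add: abs_le_iff)
    ultimately show "z \<in> ?P (Suc m)" by blast
  next
    fix z assume "z \<in> ?P (Suc m)"
    then obtain c where c: "\<forall>k. \<bar>c k\<bar> \<le> 1" and z: "z = (\<Sum>k<m. c k *\<^sub>R b k) + c m *\<^sub>R b m" by auto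
    have "- 1 \<le> c m" "c m \<le> 1" using spec[OF c, of m] by linarith+
    then have "c m *\<^sub>R b m \<in> ?I" by (intro imageI) simp
    then show "z \<in> {v + w | v w. v \<in> ?P m \<and> w \<in> ?I}" using c z by blast
  qed
  moreover have "compact ?I" by (intro compact_continuous_image continuous_intros) simp
  ultimately show ?case using compact_sums[OF Suc] by simp
qed


section \<open>Variations along chains\<close>

context
  fixes p :: real
  assumes p: "1 < p"
begin

abbreviation "J \<equiv> James_space p"
abbreviation "N \<equiv> cpv_norm p"

text \<open>
  Chains are allowed to repeat indices from here on: a repetition contributes zero, and weakly
  increasing chains are closed under composition with weakly increasing maps.
\<close>

definition variation :: "(nat \<Rightarrow> real) \<Rightarrow> (nat \<Rightarrow> nat) \<Rightarrow> nat \<Rightarrow> real" where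
  "variation a i m = (\<Sum>j<m. \<bar>a (i j) - a (i (Suc j))\<bar> powr p)"

definition closed_variation :: "(nat \<Rightarrow> real) \<Rightarrow> (nat \<Rightarrow> nat) \<Rightarrow> nat \<Rightarrow> real" where
  "closed_variation a i m = variation a i m + \<bar>a (i m) - a (i 0)\<bar> powr p"

lemma variation_nonneg: "0 \<le> variation a i m"
  by (simp add: variation_def sum_nonneg)

lemma closed_variation_nonneg: "0 \<le> closed_variation a i m"
  by (simp add: closed_variation_def variation_nonneg)

lemma variation_cong: "(\<And>j. j \<le> m \<Longrightarrow> i j = k j) \<Longrightarrow> variation a i m = variation a k m"
  unfolding variation_def by (intro sum.cong) auto

lemma variation_Suc:
  "variation a i (Suc m) = variation a i m + \<bar>a (i m) - a (i (Suc m))\<bar> powr p"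
  by (simp add: variation_def)

lemma cyclic_variation_eq: "cyclic_variation p a i m = closed_variation a i m powr (1 / p)"
  by (simp add: cyclic_variation_def closed_variation_def variation_def sum.atLeast1_atMost_eq)

text \<open>The factor \<open>2\<close> on the right absorbs the normalising factor in the norm.\<close>

lemma cyclic_variation_le_iff:
  assumes "0 \<le> K"
  shows "cyclic_variation p a i m \<le> 2 powr (1 / p) * K \<longleftrightarrow> closed_variation a i m \<le> 2 * K powr p"
proof -
  have "2 powr (1 / p) * K = (2 * K powr p) powr (1 / p)"
    using p assms by (simp add: powr_mult powr_powr)
  moreover have "u powr (1 / p) \<le> v powr (1 / p) \<longleftrightarrow> u \<le> v" if "0 \<le> u" "0 \<le> v" for u v :: real
    using that p powr_mono2[of "1 / p" u v] powr_mono2[of p "u powr (1 / p)" "v powr (1 / p)"]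
    by (auto simp: powr_powr)
  ultimately show ?thesis
    using closed_variation_nonneg[of a i m] by (simp add: cyclic_variation_eq)
qed

lemma strict_chain_of_mono_chain:
  assumes "mono i"
  shows "\<exists>k n. strict_mono_on {0..n} k \<and> k 0 = i 0 \<and> k n = i m \<and> variation a k n = variation a i m"
proof (induction m)
  case 0
  show ?case
    by (intro exI[of _ i] exI[of _ 0]) (auto simp: strict_mono_on_def variation_def)
next
  case (Suc m)
  then obtain k n where k: "strict_mono_on {0..n} k" "k 0 = i 0" "k n = i m"
    "variation a k n = variation a i m" by blast
  show ?case
  proof (cases "i (Suc m) = i m")
    case True
    then show ?thesis using k p by (intro exI[of _ k] exI[of _ n]) (simp add: variation_Suc)
  next
    case False
    then have lt: "i m < i (Suc m)" using monoD[OF assms, of m "Suc m"] by simp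
    define k' where "k' = k(Suc n := i (Suc m))"
    have "k r < i (Suc m)" if "r \<le> n" for r
    proof -
      have "k r \<le> k n" using k(1) that by (cases "r = n") (auto simp: strict_mono_on_def less_imp_le)
      then show ?thesis using lt k(3) by simp
    qed
    then have "strict_mono_on {0..Suc n} k'"
      using k(1) by (auto simp: strict_mono_on_def k'_def)
    moreover have "variation a k' (Suc n) = variation a i (Suc m)"
      using variation_cong[of n k' k a] k(3,4) by (simp add: variation_Suc k'_def)
    moreover have "k' 0 = i 0" "k' (Suc n) = i (Suc m)" using k(2) by (simp_all add: k'_def)
    ultimately show ?thesis by blast
  qed
qed

lemma closed_variation_le:
  assumes a: "a \<in> J" and i: "mono i"
  shows "closed_variation a i m \<le> 2 * N a powr p"
proof -
  have bdd: "bdd_above (cyclic_variations p a)" using a by (simp add: James_space_def)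
  obtain k n where k: "strict_mono_on {0..n} k" "k 0 = i 0" "k n = i m"
    "variation a k n = variation a i m" using strict_chain_of_mono_chain[OF i] by metis
  then have eq: "closed_variation a i m = closed_variation a k n"
    by (simp add: closed_variation_def)
  show ?thesis
  proof (cases "n = 0")
    case True
    then have "closed_variation a k n = 0" using p by (simp add: closed_variation_def variation_def)
    then show ?thesis by (simp add: eq)
  next
    case False
    then have "cyclic_variation p a k n \<le> 2 powr (1 / p) * N a"
      using bdd k(1) by (intro cyclic_variation_le_cpv_norm) auto
    then show ?thesis using cyclic_variation_le_iff[OF cpv_norm_nonneg[OF bdd]] eq by simp
  qed
qed

lemma cpv_norm_boundI:
  assumes K: "0 \<le> K" and le: "\<And>i m. mono i \<Longrightarrow> closed_variation a i m \<le> 2 * K powr p"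
  shows "N a \<le> K" "bdd_above (cyclic_variations p a)"
proof -
  have *: "cyclic_variation p a i m \<le> 2 powr (1 / p) * K" if "strict_mono_on {0..m} i" for i m
  proof -
    have "i r \<le> i s" if "r \<le> s" "s \<le> m" for r s
      using \<open>strict_mono_on {0..m} i\<close> that
      by (cases "r = s") (auto simp: strict_mono_on_def less_imp_le)
    \<comment> \<open>A chain is only increasing up to \<open>m\<close>; it is continued as a constant.\<close>
    then have "mono (\<lambda>j. i (min j m))" by (intro monoI) auto
    from le[OF this, of m] have "closed_variation a i m \<le> 2 * K powr p"
      using variation_cong[of m "\<lambda>j. i (min j m)" i a] by (simp add: closed_variation_def)
    then show ?thesis using cyclic_variation_le_iff[OF K] by simp
  qed
  from cpv_norm_leI[OF *] show "N a \<le> K" "bdd_above (cyclic_variations p a)" by auto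
qed

lemma subspace_J: "subspace J"
  using p by (intro subspace_James_space) simp

lemma N_nonneg: "a \<in> J \<Longrightarrow> 0 \<le> N a"
  by (intro cpv_norm_nonneg) (simp add: James_space_def)

lemma N_diff: "a \<in> J \<Longrightarrow> b \<in> J \<Longrightarrow> N (a - b) \<le> N a + N b"
  using cpv_norm_add(1)[of p a "(-1) *\<^sub>R b"] cpv_norm_scaleR[of p b "-1"] p
  by (auto simp: James_space_def)


section \<open>The upper estimate for disjointly supported sequences\<close>

lemma conjugate_exponent:
  assumes "1 / p + 1 / q = 1"
  shows "1 < q" and "(q - 1) * p = q"
proof -
  have "0 < 1 / p" "1 / p < 1" using p by auto
  then have q: "0 < 1 / q" "1 / q < 1" using assms by linarith+
  from q(1) have "0 < q" by simp
  then show "1 < q" using q(2) by simp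
  show "(q - 1) * p = q" using assms p \<open>0 < q\<close> by (simp add: field_simps)
qed

lemma sum_two_terms_powr:
  fixes \<alpha> :: "'i \<Rightarrow> real"
  assumes fin: "finite K" and two: "\<And>k. k \<in> K \<Longrightarrow> \<alpha> k \<noteq> 0 \<Longrightarrow> k = k0 \<or> k = l0"
  shows "\<bar>\<Sum>k\<in>K. \<alpha> k\<bar> powr p \<le> 2 powr p * (\<Sum>k\<in>K. \<bar>\<alpha> k\<bar> powr p)"
proof -
  define D where "D = {k \<in> K. \<alpha> k \<noteq> 0}"
  have finD: "finite D" and DK: "D \<subseteq> K" using fin by (auto simp: D_def)
  have "D \<subseteq> {k0, l0}" using two by (auto simp: D_def)
  then have "card D \<le> card {k0, l0}" by (intro card_mono) auto
  also have "\<dots> \<le> 2" by (simp add: card_insert_if)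
  finally have card: "card D \<le> 2" .
  have eq: "(\<Sum>k\<in>K. \<alpha> k) = (\<Sum>k\<in>D. \<alpha> k)"
    by (rule sum.mono_neutral_right) (use fin in \<open>auto simp: D_def\<close>)
  show ?thesis
  proof (cases "D = {}")
    case True
    then show ?thesis using p by (simp add: eq sum_nonneg)
  next
    case False
    define b where "b = Max ((\<lambda>k. \<bar>\<alpha> k\<bar>) ` D)"
    have "b \<in> (\<lambda>k. \<bar>\<alpha> k\<bar>) ` D" unfolding b_def using finD False by (intro Max_in) auto
    then obtain k where k: "k \<in> D" "b = \<bar>\<alpha> k\<bar>" by blast
    have "\<bar>\<Sum>k\<in>D. \<alpha> k\<bar> \<le> (\<Sum>k\<in>D. \<bar>\<alpha> k\<bar>)" by (rule sum_abs)
    also have "\<dots> \<le> real (card D) * b"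
      using finD by (intro sum_bounded_above) (auto simp: b_def)
    also have "\<dots> \<le> 2 * b" using card k(2) by (intro mult_right_mono) auto
    finally have "\<bar>\<Sum>k\<in>D. \<alpha> k\<bar> powr p \<le> (2 * b) powr p" using p by (intro powr_mono2) auto
    also have "\<dots> = 2 powr p * \<bar>\<alpha> k\<bar> powr p" using k(2) by (simp add: powr_mult)
    also have "\<dots> \<le> 2 powr p * (\<Sum>k\<in>K. \<bar>\<alpha> k\<bar> powr p)"
      using k(1) DK fin by (intro mult_left_mono member_le_sum) auto
    finally show ?thesis by (simp add: eq)
  qed
qed

lemma sum_scaleR_apply:
  fixes y :: "nat \<Rightarrow> nat \<Rightarrow> real"
  shows "(\<Sum>k<n. c k *\<^sub>R y k) s = (\<Sum>k<n. c k * y k s)"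
  by (induct n) (auto simp: scaleR_fun_def)

text \<open>
  Every difference \<open>w s - w t\<close> of the combined sequence involves at most two of the \<open>y k\<close>, those
  whose supports contain \<open>s\<close> or \<open>t\<close>. Hence, along any fixed chain and up to a factor
  \<open>2 powr p\<close>, the \<open>p\<close>-th powers of the variations add up.
\<close>

lemma upper_p_estimate:
  fixes y :: "nat \<Rightarrow> nat \<Rightarrow> real"
  assumes y: "\<And>k. y k \<in> J" "\<And>k. N (y k) \<le> M"
    and disj: "\<And>k l s. y k s \<noteq> 0 \<Longrightarrow> y l s \<noteq> 0 \<Longrightarrow> k = l"
  shows "N (\<Sum>k<n. c k *\<^sub>R y k) \<le> 2 * M * (\<Sum>k<n. \<bar>c k\<bar> powr p) powr (1 / p)"
proof (rule cpv_norm_boundI(1))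
  have M: "0 \<le> M" using N_nonneg[OF y(1)] y(2) order_trans by blast
  show "0 \<le> 2 * M * (\<Sum>k<n. \<bar>c k\<bar> powr p) powr (1 / p)" using M by simp
  define w where "w = (\<Sum>k<n. c k *\<^sub>R y k)"
  have w: "\<bar>w s - w t\<bar> powr p \<le> 2 powr p * (\<Sum>k<n. \<bar>c k\<bar> powr p * \<bar>y k s - y k t\<bar> powr p)" for s t
  proof -
    obtain k0 where k0: "\<And>k. y k s \<noteq> 0 \<Longrightarrow> k = k0" using disj by metis
    obtain l0 where l0: "\<And>k. y k t \<noteq> 0 \<Longrightarrow> k = l0" using disj by metis
    have "w r = (\<Sum>k<n. c k * y k r)" for r unfolding w_def by (rule sum_scaleR_apply)
    then have "w s - w t = (\<Sum>k<n. c k * (y k s - y k t))"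
      by (simp add: sum_subtractf right_diff_distrib)
    then have "\<bar>w s - w t\<bar> powr p \<le> 2 powr p * (\<Sum>k<n. \<bar>c k * (y k s - y k t)\<bar> powr p)"
      using sum_two_terms_powr[of "{..<n}" "\<lambda>k. c k * (y k s - y k t)" k0 l0] k0 l0 by force
    then show ?thesis by (simp add: abs_mult powr_mult)
  qed
  fix i :: "nat \<Rightarrow> nat" and m assume i: "mono i"
  have "closed_variation w i m \<le>
      (\<Sum>j<m. 2 powr p * (\<Sum>k<n. \<bar>c k\<bar> powr p * \<bar>y k (i j) - y k (i (Suc j))\<bar> powr p)) +
      2 powr p * (\<Sum>k<n. \<bar>c k\<bar> powr p * \<bar>y k (i m) - y k (i 0)\<bar> powr p)"
    unfolding closed_variation_def variation_def by (intro add_mono sum_mono w)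
  also have "\<dots> = 2 powr p * (\<Sum>k<n. \<bar>c k\<bar> powr p * closed_variation (y k) i m)"
    unfolding closed_variation_def variation_def
    by (simp add: distrib_left sum.distrib sum_distrib_left sum.swap[of _ "{..<n}" "{..<m}"])
  also have "\<dots> \<le> 2 powr p * (\<Sum>k<n. \<bar>c k\<bar> powr p * (2 * M powr p))"
  proof (intro mult_left_mono sum_mono)
    fix k
    have "closed_variation (y k) i m \<le> 2 * N (y k) powr p" by (rule closed_variation_le[OF y(1) i])
    also have "\<dots> \<le> 2 * M powr p"
      using p y N_nonneg[OF y(1)] by (intro mult_left_mono powr_mono2) auto
    finally show "closed_variation (y k) i m \<le> 2 * M powr p" .
  qed auto
  also have "\<dots> = 2 * (2 * M * (\<Sum>k<n. \<bar>c k\<bar> powr p) powr (1 / p)) powr p"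
    using M p by (simp add: powr_mult powr_powr sum_nonneg flip: sum_distrib_right)
  finally show "closed_variation (\<Sum>k<n. c k *\<^sub>R y k) i m
      \<le> 2 * (2 * M * (\<Sum>k<n. \<bar>c k\<bar> powr p) powr (1 / p)) powr p"
    unfolding w_def .
qed

lemma bounded_operator_on_bound:
  assumes "bounded_operator_on J N T"
  obtains K where "0 \<le> K" "\<And>x. x \<in> J \<Longrightarrow> norm (T x) \<le> K * N x"
proof -
  obtain K where K: "\<And>x. x \<in> J \<Longrightarrow> norm (T x) \<le> K * N x"
    using assms unfolding bounded_operator_on_def by blast
  have "norm (T x) \<le> max K 0 * N x" if "x \<in> J" for x
    using K[OF that] mult_right_mono[OF max.cobounded1[of K 0] N_nonneg[OF that]] by linarith
  then show ?thesis by (intro that[of "max K 0"]) auto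
qed

text \<open>
  This is the duality between \<open>\<ell>\<^sub>p\<close> and \<open>\<ell>\<^sub>q\<close>: testing \<open>g\<close> on the combination with coefficients
  \<open>sgn (g (y k)) * \<bar>g (y k)\<bar> powr (q - 1)\<close> bounds each partial sum \<open>A\<close> of the
  \<open>q\<close>-th powers by a multiple of \<open>A powr (1 / p)\<close>, hence \<open>A powr (1 / q)\<close> by a constant.
\<close>

lemma disjoint_weakly_summable:
  fixes y :: "nat \<Rightarrow> nat \<Rightarrow> real"
  assumes pq: "1 / p + 1 / q = 1"
    and y: "\<And>k. y k \<in> J" "\<And>k. N (y k) \<le> M"
    and disj: "\<And>k l s. y k s \<noteq> 0 \<Longrightarrow> y l s \<noteq> 0 \<Longrightarrow> k = l"
  shows "weakly_summable_on J N q y"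
  unfolding weakly_summable_on_def
proof (intro conjI allI ballI y(1))
  have q: "0 < q" and qp: "(q - 1) * p = q" using conjugate_exponent[OF pq] by simp_all
  fix g assume "g \<in> dual_on J N"
  then have g: "bounded_operator_on J N g" by (simp add: dual_on_def)
  obtain K where K: "0 \<le> K" "\<And>x. x \<in> J \<Longrightarrow> norm (g x) \<le> K * N x"
    using bounded_operator_on_bound[OF g] by blast
  have M: "0 \<le> M" using N_nonneg[OF y(1)] y(2) order_trans by blast
  show "summable (\<lambda>k. \<bar>g (y k)\<bar> powr q)"
  proof (rule summableI_nonneg_bounded)
    fix n
    define A where "A = (\<Sum>k<n. \<bar>g (y k)\<bar> powr q)"
    define c where "c = (\<lambda>k. sgn (g (y k)) * \<bar>g (y k)\<bar> powr (q - 1))"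
    have A: "0 \<le> A" by (simp add: A_def sum_nonneg)
    have cg: "c k * g (y k) = \<bar>g (y k)\<bar> powr q" for k
    proof (cases "g (y k) = 0")
      case False
      have "c k * g (y k) = (g (y k) * sgn (g (y k))) * \<bar>g (y k)\<bar> powr (q - 1)"
        by (simp add: c_def)
      also have "\<dots> = \<bar>g (y k)\<bar> powr 1 * \<bar>g (y k)\<bar> powr (q - 1)"
        by (simp flip: abs_sgn)
      also have "\<dots> = \<bar>g (y k)\<bar> powr q"
        using powr_add[of "\<bar>g (y k)\<bar>" 1 "q - 1"] by simp
      finally show ?thesis .
    qed (use q in \<open>simp add: c_def\<close>)
    have cp: "\<bar>c k\<bar> powr p = \<bar>g (y k)\<bar> powr q" for k
      using qp q by (cases "g (y k) = 0") (auto simp: c_def abs_mult abs_sgn_eq powr_powr)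
    have wJ: "(\<Sum>k<n. c k *\<^sub>R y k) \<in> J"
      by (intro subspace_sum subspace_scale subspace_J y(1))
    have "A = g (\<Sum>k<n. c k *\<^sub>R y k)"
      unfolding bounded_operator_on_sum[OF g subspace_J y(1)] A_def by (simp add: cg)
    also have "\<dots> \<le> K * N (\<Sum>k<n. c k *\<^sub>R y k)" using K(2)[OF wJ] by simp
    also have "\<dots> \<le> K * (2 * M * (\<Sum>k<n. \<bar>c k\<bar> powr p) powr (1 / p))"
      by (intro mult_left_mono upper_p_estimate y disj K)
    finally have le: "A \<le> 2 * K * M * A powr (1 / p)" by (simp add: cp A_def)
    have "A powr (1 / q) \<le> 2 * K * M"
    proof (cases "A = 0")
      case False
      have "A powr (1 / p) * A powr (1 / q) = A powr (1 / p + 1 / q)" by (rule powr_add[symmetric])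
      then have "A powr (1 / p) * A powr (1 / q) = A" using A by (simp add: pq)
      then have "A powr (1 / q) * A powr (1 / p) \<le> 2 * K * M * A powr (1 / p)"
        using le by (simp add: mult.commute)
      then show ?thesis using False A by simp
    qed (use K M in simp)
    then have "(A powr (1 / q)) powr q \<le> (2 * K * M) powr q" using q by (intro powr_mono2) auto
    then show "(\<Sum>k<n. \<bar>g (y k)\<bar> powr q) \<le> (2 * K * M) powr q"
      using q A by (simp add: powr_powr flip: A_def)
  qed simp
qed


section \<open>Truncation\<close>

definition tail :: "nat \<Rightarrow> (nat \<Rightarrow> real) \<Rightarrow> nat \<Rightarrow> real" where
  "tail a x = (\<lambda>t. if t < a then 0 else x t)"

text \<open>
  Variations of \<open>tail a x\<close> suffer from its jump at \<open>a\<close>. The following sequence has no such jump, as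
  its variation along a chain is the variation of \<open>x\<close> along the chain moved up to \<open>a\<close>, and it
  differs from \<open>tail a x\<close> only by a multiple of an initial segment.
\<close>

definition clamp_below :: "nat \<Rightarrow> (nat \<Rightarrow> real) \<Rightarrow> nat \<Rightarrow> real" where
  "clamp_below a x = (\<lambda>t. x (max a t))"

definition initial_segment :: "nat \<Rightarrow> nat \<Rightarrow> real" where
  "initial_segment a = (\<lambda>t. if t < a then 1 else 0)"

lemma tail_eq: "tail a x = clamp_below a x - x a *\<^sub>R initial_segment a"
  by (auto simp: fun_eq_iff tail_def clamp_below_def initial_segment_def scaleR_fun_def max_def)

lemma initial_segment:
  shows "initial_segment a \<in> J" and "N (initial_segment a) \<le> 1"
proof -
  define h where "h = initial_segment a"
  have h: "closed_variation h i m \<le> 2 * 1 powr p" if i: "mono i" for i m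
  proof -
    \<comment> \<open>\<open>h\<close> is decreasing with values in \<open>{0, 1}\<close>, so the powers disappear and the sum telescopes.\<close>
    have "\<bar>h (i j) - h (i (Suc j))\<bar> powr p = h (i j) - h (i (Suc j))" for j
      using monoD[OF i, of j "Suc j"] p by (auto simp: h_def initial_segment_def)
    then have "variation h i m = h (i 0) - h (i m)"
      using sum_lessThan_telescope'[of "\<lambda>j. h (i j)" m] by (simp add: variation_def)
    moreover have "\<bar>h (i m) - h (i 0)\<bar> powr p \<le> 1"
      using p by (auto simp: h_def initial_segment_def)
    ultimately show ?thesis by (auto simp: closed_variation_def h_def initial_segment_def)
  qed
  show "N (initial_segment a) \<le> 1" using cpv_norm_boundI(1)[OF _ h] by (simp add: h_def)
  have "(\<lambda>t. initial_segment a t) \<longlonglongrightarrow> 0"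
    by (rule tendsto_eventually)
       (auto simp: initial_segment_def intro!: eventually_mono[OF eventually_ge_at_top[of a]])
  then show "initial_segment a \<in> J"
    using cpv_norm_boundI(2)[OF _ h] by (simp add: h_def James_space_def)
qed

lemma closed_variation_clamp_below:
  "closed_variation (clamp_below a x) i m = closed_variation x (\<lambda>j. max a (i j)) m"
  by (simp add: closed_variation_def variation_def clamp_below_def)

lemma clamp_below:
  assumes x: "x \<in> J"
  shows "clamp_below a x \<in> J" and "N (clamp_below a x) \<le> N x"
proof -
  have le: "closed_variation (clamp_below a x) i m \<le> 2 * N x powr p" if "mono i" for i m
    unfolding closed_variation_clamp_below
    by (intro closed_variation_le x) (use that in \<open>auto simp: mono_def max.coboundedI2\<close>)
  from cpv_norm_boundI(1)[OF N_nonneg[OF x] le] show "N (clamp_below a x) \<le> N x" .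
  have "clamp_below a x \<longlonglongrightarrow> 0"
  proof (rule Lim_transform_eventually)
    show "x \<longlonglongrightarrow> 0" using x by (simp add: James_space_def)
    show "\<forall>\<^sub>F t in sequentially. x t = clamp_below a x t"
      by (rule eventually_mono[OF eventually_ge_at_top[of a]]) (simp add: clamp_below_def max_def)
  qed
  then show "clamp_below a x \<in> J"
    using cpv_norm_boundI(2)[OF N_nonneg[OF x] le] by (simp add: James_space_def)
qed

lemma tail:
  assumes x: "x \<in> J"
  shows tail_in: "tail a x \<in> J" and N_tail_le: "N (tail a x) \<le> N (clamp_below a x) + \<bar>x a\<bar>"
proof -
  have sJ: "x a *\<^sub>R initial_segment a \<in> J"
    by (intro subspace_scale subspace_J initial_segment)
  show "tail a x \<in> J"
    unfolding tail_eq by (intro subspace_diff subspace_J clamp_below x sJ)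
  have "N (x a *\<^sub>R initial_segment a) = \<bar>x a\<bar> * N (initial_segment a)"
    using p initial_segment(1) by (intro cpv_norm_scaleR(1)) (auto simp: James_space_def)
  also have "\<dots> \<le> \<bar>x a\<bar>" using initial_segment(2)[of a] by (intro mult_left_le) auto
  finally show "N (tail a x) \<le> N (clamp_below a x) + \<bar>x a\<bar>"
    using N_diff[OF clamp_below(1)[OF x, of a] sJ] unfolding tail_eq by simp
qed

text \<open>
  A chain that almost attains the supremum of the variations leaves almost nothing for chains
  that start beyond its end.
\<close>

lemma clamp_below_small:
  assumes x: "x \<in> J" and e: "0 < e"
  shows "\<exists>a0. \<forall>a\<ge>a0. N (clamp_below a x) \<le> e"
proof -
  define A where "A = {variation x i m | i m. mono i}"
  have "variation x i m \<le> 2 * N x powr p" if "mono i" for i m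
    using closed_variation_le[OF x that, of m] powr_ge_zero[of "\<bar>x (i m) - x (i 0)\<bar>" p]
    unfolding closed_variation_def by linarith
  then have bdd: "bdd_above A" unfolding A_def by (intro bdd_aboveI) auto
  have "variation x (\<lambda>j. j) 0 \<in> A" unfolding A_def by (auto simp: mono_def)
  then have "A \<noteq> {}" by blast
  moreover have "Sup A - e powr p < Sup A" using e by simp
  ultimately obtain v where "v \<in> A" "Sup A - e powr p < v" using less_cSupD by blast
  then obtain i m where i: "mono i" and im: "Sup A - e powr p < variation x i m"
    unfolding A_def by blast
  have "N (clamp_below a x) \<le> e" if a: "i m \<le> a" for a
  proof (rule cpv_norm_boundI(1))
    have var: "variation (clamp_below a x) k n \<le> e powr p" if k: "mono k" for k n
    proof -
      \<comment> \<open>\<open>l\<close> runs through the chain \<open>i\<close> and then through the chain \<open>k\<close> moved up to \<open>a\<close>.\<close>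
      define l where "l = (\<lambda>j. if j \<le> m then i j else max a (k (j - Suc m)))"
      have "l r \<le> l s" if "r \<le> s" for r s
      proof -
        consider "s \<le> m" | "r \<le> m" "m < s" | "m < r" by linarith
        then show ?thesis
        proof cases
          case 2
          then have "l r \<le> i m" using monoD[OF i, of r m] by (simp add: l_def)
          also have "\<dots> \<le> l s" using 2 a by (simp add: l_def)
          finally show ?thesis .
        next
          case 3
          then show ?thesis
            using that monoD[OF k, of "r - Suc m" "s - Suc m"] by (simp add: l_def max.coboundedI2)
        qed (use that monoD[OF i, of r s] in \<open>simp add: l_def\<close>)
      qed
      then have "mono l" by (rule monoI)
      then have "variation x l (m + Suc n) \<le> Sup A"
        using bdd by (intro cSup_upper) (auto simp: A_def)
      moreover have "variation x i m + variation (clamp_below a x) k n \<le> variation x l (m + Suc n)"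
      proof (induction n)
        case 0
        have "variation x l m = variation x i m" by (rule variation_cong) (simp add: l_def)
        then show ?case by (simp add: variation_Suc variation_def[of "clamp_below a x"])
      next
        case (Suc n)
        have "l (Suc (m + n)) = max a (k n)" "l (Suc (Suc (m + n))) = max a (k (Suc n))"
          by (simp_all add: l_def)
        then have "variation x l (m + Suc (Suc n)) =
            variation x l (m + Suc n) + \<bar>x (max a (k n)) - x (max a (k (Suc n)))\<bar> powr p"
          using variation_Suc[of x l "Suc (m + n)"] by simp
        moreover have "variation (clamp_below a x) k (Suc n) =
            variation (clamp_below a x) k n + \<bar>x (max a (k n)) - x (max a (k (Suc n)))\<bar> powr p"
          unfolding variation_Suc by (simp add: clamp_below_def[THEN fun_cong])
        ultimately show ?case using Suc by linarith
      qed
      ultimately show ?thesis using im by simp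
    qed
    fix k :: "nat \<Rightarrow> nat" and n assume k: "mono k"
    \<comment> \<open>The closing difference is the variation along the chain \<open>k 0, k n\<close>.\<close>
    have "mono (\<lambda>j::nat. if j = 0 then k 0 else k n)"
      using monoD[OF k, of 0 n] by (auto simp: mono_def)
    from var[OF this, of 1]
    have "\<bar>clamp_below a x (k n) - clamp_below a x (k 0)\<bar> powr p \<le> e powr p"
      by (simp add: variation_def abs_minus_commute)
    then show "closed_variation (clamp_below a x) k n \<le> 2 * e powr p"
      using var[OF k, of n] by (simp add: closed_variation_def)
  qed (use e in simp)
  then show ?thesis by blast
qed

lemma tail_tendsto_0:
  assumes x: "x \<in> J"
  shows "(\<lambda>a. N (tail a x)) \<longlonglongrightarrow> 0"
proof (rule tendsto_sandwich[OF _ _ tendsto_const])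
  have "(\<lambda>a. N (clamp_below a x)) \<longlonglongrightarrow> 0"
  proof (rule LIMSEQ_I)
    fix e :: real assume "0 < e"
    then obtain a0 where a0: "\<forall>a\<ge>a0. N (clamp_below a x) \<le> e / 2"
      using clamp_below_small[OF x, of "e / 2"] by auto
    have "norm (N (clamp_below a x) - 0) < e" if "a \<ge> a0" for a
      using a0 that N_nonneg[OF clamp_below(1)[OF x, of a]] \<open>0 < e\<close> by force
    then show "\<exists>a0. \<forall>a\<ge>a0. norm (N (clamp_below a x) - 0) < e" by blast
  qed
  moreover have "(\<lambda>a. \<bar>x a\<bar>) \<longlonglongrightarrow> 0"
    using x by (auto simp: James_space_def intro: tendsto_rabs_zero)
  ultimately show "(\<lambda>a. N (clamp_below a x) + \<bar>x a\<bar>) \<longlonglongrightarrow> 0"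
    using tendsto_add by fastforce
qed (auto simp: N_nonneg tail_in N_tail_le x)


section \<open>Unconditionally converging operators are compact\<close>

text \<open>
  If this failed, vectors of the unit ball could be truncated to successive, hence disjoint, bounded
  blocks on which \<open>T\<close> stays away from zero. The blocks are weakly \<open>q\<close>-summable, so their images
  tend to zero in norm.
\<close>

lemma uniformly_small_tails:
  fixes T :: "(nat \<Rightarrow> real) \<Rightarrow> 'b::real_normed_vector"
  assumes pq: "1 / p + 1 / q = 1" and T: "unconditionally_converging_on J N q T" and e: "0 < e"
  shows "\<exists>m. \<forall>x\<in>unit_ball_on J N. norm (T (tail m x)) \<le> e"
proof (rule ccontr)
  assume "\<not> ?thesis"
  then have large: "\<exists>x. x \<in> unit_ball_on J N \<and> e < norm (T (tail m x))" for m
    by (simp add: not_le Bex_def)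
  have bo: "bounded_operator_on J N T" using T unfolding unconditionally_converging_on_def by blast
  obtain K where K: "0 \<le> K" "\<And>x. x \<in> J \<Longrightarrow> norm (T x) \<le> K * N x"
    using bounded_operator_on_bound[OF bo] by blast
  have "\<exists>x n. x \<in> unit_ball_on J N \<and> m < n \<and> e < norm (T (tail m x - tail n x))" for m
  proof -
    obtain x where x: "x \<in> unit_ball_on J N" "e < norm (T (tail m x))" using large by blast
    then have xJ: "x \<in> J" by (simp add: unit_ball_on_def)
    have "(\<lambda>n. T (tail n x)) \<longlonglongrightarrow> 0"
    proof (rule Lim_null_comparison)
      show "\<forall>\<^sub>F n in sequentially. norm (T (tail n x)) \<le> K * N (tail n x)"
        using K(2)[OF tail_in[OF xJ]] by simp
      show "(\<lambda>n. K * N (tail n x)) \<longlonglongrightarrow> 0"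
        using tendsto_mult_left[OF tail_tendsto_0[OF xJ], of K] by simp
    qed
    from tendsto_norm[OF tendsto_diff[OF tendsto_const this]]
    have "(\<lambda>n. norm (T (tail m x) - T (tail n x))) \<longlonglongrightarrow> norm (T (tail m x) - 0)" .
    then have "\<forall>\<^sub>F n in sequentially. e < norm (T (tail m x) - T (tail n x))"
      using x(2) by (intro order_tendstoD(1)) auto
    then have "\<forall>\<^sub>F n in sequentially. m < n \<and> e < norm (T (tail m x - tail n x))"
      using eventually_gt_at_top[of m]
      by eventually_elim (simp add: bounded_operator_on_diff[OF bo subspace_J] tail_in xJ)
    then obtain n where "m < n \<and> e < norm (T (tail m x - tail n x))"
      using eventually_happens by fastforce
    with x(1) show ?thesis by blast
  qed
  then obtain X \<nu> where X: "\<And>m. X m \<in> unit_ball_on J N" and \<nu>: "\<And>m. m < \<nu> m"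
    and big: "\<And>m. e < norm (T (tail m (X m) - tail (\<nu> m) (X m)))" by metis
  have XJ: "X m \<in> J" and X1: "N (X m) \<le> 1" for m using X[of m] by (auto simp: unit_ball_on_def)
  \<comment> \<open>The \<open>k\<close>-th block occupies the indices from \<open>\<mu> k\<close> to \<open>\<mu> (Suc k) - 1\<close>.\<close>
  define \<mu> where "\<mu> = (\<lambda>k. (\<nu> ^^ k) 0)"
  have \<mu>_Suc: "\<mu> (Suc k) = \<nu> (\<mu> k)" for k by (simp add: \<mu>_def)
  have "strict_mono \<mu>" by (rule strict_monoI_Suc) (simp add: \<mu>_Suc \<nu>)
  then have \<mu>_mono: "\<mu> k \<le> \<mu> l" if "k \<le> l" for k l using that by (simp add: strict_mono_less_eq)
  define u where "u = (\<lambda>k. tail (\<mu> k) (X (\<mu> k)) - tail (\<mu> (Suc k)) (X (\<mu> k)))"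
  have support: "\<mu> k \<le> s \<and> s < \<mu> (Suc k)" if "u k s \<noteq> 0" for k s
    using that \<mu>_mono[of k "Suc k"] by (auto simp: u_def tail_def split: if_splits)
  have disj: "k = l" if s: "u k s \<noteq> 0" "u l s \<noteq> 0" for k l s
  proof (rule linorder_cases)
    show "k = l" if "k < l" using support[OF s(1)] support[OF s(2)] \<mu>_mono[of "Suc k" l] that by simp
    show "k = l" if "l < k" using support[OF s(1)] support[OF s(2)] \<mu>_mono[of "Suc l" k] that by simp
  qed
  have t2: "N (tail m (X n)) \<le> 2" for m n
    using N_tail_le[OF XJ, of m n] clamp_below(2)[OF XJ, of m n] X1[of n]
      abs_le_cpv_norm[of p "X n" m] p XJ[of n] by simp
  have "weakly_summable_on J N q u"
  proof (rule disjoint_weakly_summable[OF pq _ _ disj])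
    show "u k \<in> J" for k unfolding u_def by (intro subspace_diff subspace_J tail_in XJ)
    show "N (u k) \<le> 4" for k
      using N_diff[OF tail_in[OF XJ, of "\<mu> k" "\<mu> k"] tail_in[OF XJ, of "\<mu> (Suc k)" "\<mu> k"]]
        t2[of "\<mu> k" "\<mu> k"] t2[of "\<mu> (Suc k)" "\<mu> k"]
      unfolding u_def by linarith
  qed
  then have "unconditionally_summable_on UNIV norm q (\<lambda>k. T (u k))"
    using T unfolding unconditionally_converging_on_def by blast
  moreover have "1 \<le> q" using conjugate_exponent(1)[OF pq] by simp
  ultimately have "(\<lambda>k. norm (T (u k))) \<longlonglongrightarrow> 0"
    using unconditionally_summable_norm_tendsto_0 by blast
  then have "\<forall>\<^sub>F k in sequentially. norm (T (u k)) < e"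
    using e by (intro order_tendstoD(2))
  then obtain k where "norm (T (u k)) < e" using eventually_happens by fastforce
  then show False using big[of "\<mu> k"] by (simp add: u_def \<mu>_Suc)
qed

text \<open>The unit vectors are differences of consecutive initial segments.\<close>

lemma minus_tail_eq_sum:
  "x - tail m x = (\<Sum>k<m. x k *\<^sub>R (initial_segment (Suc k) - initial_segment k))"
proof -
  have "(\<Sum>k<m. x k * (initial_segment (Suc k) - initial_segment k) s) = (if s < m then x s else 0)"
    for s
    by (induction m) (auto simp: initial_segment_def less_Suc_eq)
  then show ?thesis
    unfolding fun_eq_iff sum_scaleR_apply by (auto simp: tail_def)
qed

text \<open>By uniform smallness of the tails, \<open>T\<close> is a limit of finite rank operators, so the image of the
  unit ball is totally bounded.\<close>

lemma compact_closure_image: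
  fixes T :: "(nat \<Rightarrow> real) \<Rightarrow> 'b::banach"
  assumes pq: "1 / p + 1 / q = 1" and T: "unconditionally_converging_on J N q T"
  shows "compact (closure (T ` unit_ball_on J N))"
  unfolding compact_eq_totally_bounded
proof (intro conjI allI impI)
  show "complete (closure (T ` unit_ball_on J N))" by (simp add: complete_eq_closed)
  fix e :: real assume e: "0 < e"
  have bo: "bounded_operator_on J N T" using T unfolding unconditionally_converging_on_def by blast
  obtain m where m: "\<And>x. x \<in> unit_ball_on J N \<Longrightarrow> norm (T (tail m x)) \<le> e / 4"
    using uniformly_small_tails[OF pq T, of "e / 4"] e by auto
  define d where "d = (\<lambda>k. initial_segment (Suc k) - initial_segment k)"
  have d: "d k \<in> J" for k unfolding d_def by (intro subspace_diff subspace_J initial_segment)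
  define P where "P = {\<Sum>k<m. c k *\<^sub>R T (d k) | c. \<forall>k. \<bar>c k\<bar> \<le> 1}"
  have "compact P" unfolding P_def by (rule compact_bounded_combinations)
  then obtain F where F: "finite F" "P \<subseteq> (\<Union>z\<in>F. ball z (e / 4))"
    using e unfolding compact_eq_totally_bounded by (meson divide_pos_pos zero_less_numeral)
  have "\<exists>z\<in>F. v \<in> ball z e" if v: "v \<in> closure (T ` unit_ball_on J N)" for v
  proof -
    obtain x where x: "x \<in> unit_ball_on J N" and vx: "dist (T x) v < e / 4"
      using spec[OF v[unfolded closure_approachable], of "e / 4"] e by auto
    have xJ: "x \<in> J" and "N x \<le> 1" using x by (auto simp: unit_ball_on_def)
    then have x1: "\<forall>k. \<bar>x k\<bar> \<le> 1" using abs_le_cpv_norm[of p x] p by (meson less_imp_le order_trans)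
    have "T (x - tail m x) = (\<Sum>k<m. x k *\<^sub>R T (d k))"
      using bounded_operator_on_sum[OF bo subspace_J d, where c = x and n = m]
      by (simp only: minus_tail_eq_sum d_def)
    then have "T (x - tail m x) \<in> P" using x1 unfolding P_def by blast
    then obtain z where z: "z \<in> F" "dist z (T (x - tail m x)) < e / 4" using F(2) by auto
    have "T x = T (x - tail m x) + T (tail m x)"
      by (simp add: bounded_operator_on_diff[OF bo subspace_J xJ tail_in[OF xJ]])
    then have "dist (T (x - tail m x)) (T x) \<le> e / 4" using m[OF x] by (simp add: dist_norm)
    moreover have "dist z v \<le> dist z (T (x - tail m x)) + dist (T (x - tail m x)) (T x) + dist (T x) v"
      using dist_triangle[of z v "T (x - tail m x)"] dist_triangle[of "T (x - tail m x)" v "T x"] by simp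
    ultimately have "dist z v < e" using z(2) vx e by simp
    then show ?thesis using z(1) by auto
  qed
  then show "\<exists>F. finite F \<and> closure (T ` unit_ball_on J N) \<subseteq> (\<Union>z\<in>F. ball z e)"
    using F(1) by (intro exI[of _ F]) auto
qed

end

section \<open>James spaces have property (V) of the conjugate order\<close>

theorem theorem2p6:
  fixes p q :: real
  assumes "1 < p"
    and "1 / p + 1 / q = 1"
  shows "property_V_on TYPE('b::banach) q (James_space p) (cpv_norm p)"
  unfolding property_V_on_def
proof (intro allI impI)
  fix T :: "(nat \<Rightarrow> real) \<Rightarrow> 'b"
  assume T: "unconditionally_converging_on (James_space p) (cpv_norm p) q T"
  show "weakly_compact_operator_on (James_space p) (cpv_norm p) T"
  proof (rule compact_operator_imp_weakly_compact)
    show "bounded_operator_on (James_space p) (cpv_norm p) T"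
      using T unfolding unconditionally_converging_on_def by blast
    show "compact (closure (T ` unit_ball_on (James_space p) (cpv_norm p)))"
      by (rule compact_closure_image[OF assms T])
  qed (rule closure_subset)
qed

end
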